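(* Let $X\subset\mathbb{P}^5$ be a smooth four-dimensional quadric over $k$, and let $\mathsf{SO}_6$ be the special orthogonal group of a quadratic form defining $X$. Suppose that a finite subgroup $G\subset\mathsf{SO}_6$ acts on $X$ generically freely. Let $\widetilde{G}\subset\mathsf{SL}_4$ be the preimage of $G$ under the double cover $\mathsf{SL}_4\to\mathsf{SO}_6$. If the induced central extension $$1\to\mu_2\to\widetilde{G}\to G\to 1$$ is trivial (splits), i.e., if the restriction homomorphism $\mathrm{H}^2(\mathsf{SO}_6,\mu_2)\to\mathrm{H}^2(G,\mu_2)$ vanishes on the class of the extension $1\to\mu_2\to\mathsf{SL}_4\to\mathsf{SO}_6\to 1$, then the action of $G$ on $X$ is stably linearizable.
   Context: The base field $k$ is algebraically closed of characteristic zero. The extension $1\to\mu_2\to\mathsf{SL}_4\to\mathsf{SO}_6\to1$ is the one coming from the exceptional isomorphism $\mathsf{Spin}_6\simeq\mathsf{SL}_4$ (the action of $\mathsf{SL}_4$ on $\wedge^2 k^4$ with its wedge pairing). For a finite group $G$, a smooth variety $X$ over $k$ with a generically free regular action of $G$ is called linearizable if there is a $G$-equivariant birational map $\mathbb{P}(V)\dashrightarrow X$ for some linear representation $V$ of $G$. It is called stably linearizable if $X\times\mathbb{P}^m$, with trivial action on the second factor, is linearizable for some $m$. *)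

theory Defs
  imports
    "HOL-Analysis.Abstract_Topology"
    "HOL-Algebra.Group"
    "HOL-Computational_Algebra.Polynomial"
    "Jordan_Normal_Form.Determinant"
begin

section \<open>Projective space and its Zariski topology\<close>

text \<open>
  A point of the projective space of lines in \<open>k\<^sup>n\<close> is the set of nonzero vectors on a line,
  so \<open>proj_space n\<close> has dimension \<open>n - 1\<close>.
\<close>

definition proj_point :: "'k::field vec \<Rightarrow> 'k vec set" where
  "proj_point v = {c \<cdot>\<^sub>v v | c. c \<noteq> 0}"

definition proj_space :: "nat \<Rightarrow> 'k::field vec set set" where
  "proj_space n = proj_point ` {v \<in> carrier_vec n. v \<noteq> 0\<^sub>v n}"

text \<open>
  Homogeneous polynomials of degree \<open>d\<close> in \<open>n\<close> variables, as functions on \<open>k\<^sup>n\<close>.  The fields of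
  interest are infinite, so polynomials and polynomial functions are the same thing.
\<close>

inductive hom_poly :: "nat \<Rightarrow> nat \<Rightarrow> ('k::field vec \<Rightarrow> 'k) \<Rightarrow> bool" for n where
  zero: "hom_poly n d (\<lambda>v. 0)"
| const: "hom_poly n 0 (\<lambda>v. c)"
| coord: "i < n \<Longrightarrow> hom_poly n 1 (\<lambda>v. v $ i)"
| add: "hom_poly n d f \<Longrightarrow> hom_poly n d g \<Longrightarrow> hom_poly n d (\<lambda>v. f v + g v)"
| mult: "hom_poly n d f \<Longrightarrow> hom_poly n e g \<Longrightarrow> hom_poly n (d + e) (\<lambda>v. f v * g v)"

definition principal_open :: "nat \<Rightarrow> ('k::field vec \<Rightarrow> 'k) \<Rightarrow> 'k vec set set" where
  "principal_open n f = {p \<in> proj_space n. \<forall>v\<in>p. f v \<noteq> 0}"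

definition zariski :: "nat \<Rightarrow> 'k::field vec set topology" where
  "zariski n = topology_generated_by {principal_open n f | f d. hom_poly n d f}"

text \<open>Topology induced on a subvariety \<open>X\<close> of \<open>proj_space n\<close>.\<close>

abbreviation zariski_on :: "nat \<Rightarrow> 'k::field vec set set \<Rightarrow> 'k vec set topology" where
  "zariski_on n X \<equiv> subtopology (zariski n) X"


section \<open>Regular and birational maps\<close>

text \<open>
  A map from \<open>U \<subseteq> proj_space n\<close> to \<open>proj_space m\<close> is regular if locally it has the form
  \<open>[v] \<mapsto> [F\<^sub>0 v : \<dots> : F\<^sub>m\<^sub>-\<^sub>1 v]\<close> with \<open>F\<^sub>j\<close> homogeneous of one common degree and without common zero.
\<close>

definition regular_map ::
  "nat \<Rightarrow> nat \<Rightarrow> 'k::field vec set set \<Rightarrow> ('k vec set \<Rightarrow> 'k vec set) \<Rightarrow> bool" where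
  "regular_map n m U f \<longleftrightarrow>
    (\<forall>p\<in>U. \<exists>W d F. openin (zariski_on n U) W \<and> p \<in> W \<and> (\<forall>j<m. hom_poly n d (F j)) \<and>
      (\<forall>q\<in>W. \<forall>v\<in>q. vec m (\<lambda>j. F j v) \<noteq> 0\<^sub>v m \<and> f q = proj_point (vec m (\<lambda>j. F j v))))"

text \<open>
  For irreducible \<open>X \<subseteq> proj_space n\<close> and \<open>Y \<subseteq> proj_space m\<close>: the pair \<open>(U, f)\<close> represents a
  birational map from \<open>X\<close> to \<open>Y\<close>, where \<open>U\<close> is so small that \<open>f\<close> is an isomorphism onto an open
  subset of \<open>Y\<close>.  On an irreducible variety, nonempty open subsets are dense.
\<close>

definition birational_map ::
  "nat \<Rightarrow> 'k::field vec set set \<Rightarrow> nat \<Rightarrow> 'k vec set set \<Rightarrow>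
    'k vec set set \<Rightarrow> ('k vec set \<Rightarrow> 'k vec set) \<Rightarrow> bool" where
  "birational_map n X m Y U f \<longleftrightarrow>
    openin (zariski_on n X) U \<and> U \<noteq> {} \<and> openin (zariski_on m Y) (f ` U) \<and> inj_on f U \<and>
    regular_map n m U f \<and> regular_map m n (f ` U) (the_inv_into U f)"


section \<open>Products\<close>

text \<open>
  The product of \<open>X \<subseteq> proj_space n\<close> and \<open>Y \<subseteq> proj_space m\<close> is realised as its image under the
  Segre embedding into \<open>proj_space (n * m)\<close>.
\<close>

definition tensor_vec :: "'k::field vec \<Rightarrow> 'k vec \<Rightarrow> 'k vec" where
  "tensor_vec v w = vec (dim_vec v * dim_vec w) (\<lambda>i. v $ (i div dim_vec w) * w $ (i mod dim_vec w))"

definition segre :: "'k::field vec set \<Rightarrow> 'k vec set \<Rightarrow> 'k vec set" where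
  "segre p q = {tensor_vec v w | v w. v \<in> p \<and> w \<in> q}"

definition prod_variety :: "'k::field vec set set \<Rightarrow> 'k vec set set \<Rightarrow> 'k vec set set" where
  "prod_variety X Y = {segre p q | p q. p \<in> X \<and> q \<in> Y}"

text \<open>The action on \<open>X \<times> Y\<close> given by an action on \<open>X\<close> and the trivial action on \<open>Y\<close>.\<close>

definition prod_action ::
  "'k::field vec set set \<Rightarrow> 'k vec set set \<Rightarrow> ('g \<Rightarrow> 'k vec set \<Rightarrow> 'k vec set) \<Rightarrow>
    'g \<Rightarrow> 'k vec set \<Rightarrow> 'k vec set" where
  "prod_action X Y act g z =
    (let (p, q) = the_inv_into (X \<times> Y) (\<lambda>(p, q). segre p q) z in segre (act g p) q)"


section \<open>Group actions and linearizability\<close>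

definition GL :: "nat \<Rightarrow> 'k::field mat monoid" where
  "GL n = \<lparr>carrier = {A \<in> carrier_mat n n. invertible_mat A}, mult = (*), one = 1\<^sub>m n\<rparr>"

definition SL :: "nat \<Rightarrow> 'k::field mat monoid" where
  "SL n = \<lparr>carrier = {A \<in> carrier_mat n n. det A = 1}, mult = (*), one = 1\<^sub>m n\<rparr>"

definition proj_action :: "'k::field mat \<Rightarrow> 'k vec set \<Rightarrow> 'k vec set" where
  "proj_action A p = (\<lambda>v. A *\<^sub>v v) ` p"

definition generically_free ::
  "('g, 'b) monoid_scheme \<Rightarrow> nat \<Rightarrow> 'k::field vec set set \<Rightarrow>
    ('g \<Rightarrow> 'k vec set \<Rightarrow> 'k vec set) \<Rightarrow> bool" where
  "generically_free G n X act \<longleftrightarrow>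
    (\<exists>U. openin (zariski_on n X) U \<and> U \<noteq> {} \<and>
      (\<forall>p\<in>U. \<forall>g\<in>carrier G. act g p = p \<longrightarrow> g = \<one>\<^bsub>G\<^esub>))"

text \<open>
  A linear representation \<open>V\<close> of dimension \<open>d\<close> is a homomorphism \<open>\<rho>\<close> to \<open>GL d\<close>.  Equivariance of a
  rational map is equality of rational maps, so it is required where both sides are defined.
\<close>

definition linearizable ::
  "('g, 'b) monoid_scheme \<Rightarrow> nat \<Rightarrow> 'k::field vec set set \<Rightarrow>
    ('g \<Rightarrow> 'k vec set \<Rightarrow> 'k vec set) \<Rightarrow> bool" where
  "linearizable G n X act \<longleftrightarrow>
    (\<exists>d \<rho> U f. \<rho> \<in> hom G (GL d) \<and> birational_map d (proj_space d) n X U f \<and>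
      (\<forall>g\<in>carrier G. \<forall>p\<in>U. proj_action (\<rho> g) p \<in> U \<longrightarrow> f (proj_action (\<rho> g) p) = act g (f p)))"

definition stably_linearizable ::
  "('g, 'b) monoid_scheme \<Rightarrow> nat \<Rightarrow> 'k::field vec set set \<Rightarrow>
    ('g \<Rightarrow> 'k vec set \<Rightarrow> 'k vec set) \<Rightarrow> bool" where
  "stably_linearizable G n X act \<longleftrightarrow>
    (\<exists>m. linearizable G (n * Suc m) (prod_variety X (proj_space (Suc m)))
      (prod_action X (proj_space (Suc m)) act))"


section \<open>Quadrics and special orthogonal groups\<close>

text \<open>
  A quadratic form on \<open>k\<^sup>n\<close> in characteristic zero is given by its symmetric Gram matrix.
\<close>

definition sym_mat :: "nat \<Rightarrow> 'k::field mat \<Rightarrow> bool" where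
  "sym_mat n Q \<longleftrightarrow> Q \<in> carrier_mat n n \<and> transpose_mat Q = Q"

definition quad_form :: "'k::field mat \<Rightarrow> 'k vec \<Rightarrow> 'k" where
  "quad_form Q v = v \<bullet> (Q *\<^sub>v v)"

definition quadric :: "nat \<Rightarrow> 'k::field mat \<Rightarrow> 'k vec set set" where
  "quadric n Q = {p \<in> proj_space n. \<forall>v\<in>p. quad_form Q v = 0}"

text \<open>Jacobian criterion: for symmetric \<open>Q\<close>, the gradient of \<open>quad_form Q\<close> at \<open>v\<close> is \<open>2 Q v\<close>.\<close>

definition smooth_quadric :: "nat \<Rightarrow> 'k::field mat \<Rightarrow> bool" where
  "smooth_quadric n Q \<longleftrightarrow>
    (\<forall>p\<in>quadric n Q. \<forall>v\<in>p. 2 \<cdot>\<^sub>v (Q *\<^sub>v v) \<noteq> 0\<^sub>v n)"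

definition SO :: "nat \<Rightarrow> 'k::field mat \<Rightarrow> 'k mat monoid" where
  "SO n Q = \<lparr>carrier = {A \<in> carrier_mat n n. transpose_mat A * Q * A = Q \<and> det A = 1},
    mult = (*), one = 1\<^sub>m n\<rparr>"


section \<open>The double cover of the special orthogonal group in dimension six\<close>

text \<open>
  Coordinates on \<open>\<And>\<^sup>2 k\<^sup>4\<close> refer to the basis \<open>e\<^sub>i \<and> e\<^sub>j\<close> with \<open>(i, j)\<close> running through
  \<open>wedge_basis\<close>.
\<close>

definition wedge_basis :: "(nat \<times> nat) list" where
  "wedge_basis = [(0,1), (0,2), (0,3), (1,2), (1,3), (2,3)]"

text \<open>The action of \<open>A\<close> on \<open>\<And>\<^sup>2 k\<^sup>4\<close>, \<open>v \<and> w \<mapsto> A v \<and> A w\<close>; its entries are the minors of \<open>A\<close>.\<close>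

definition wedge2 :: "'k::field mat \<Rightarrow> 'k mat" where
  "wedge2 A = mat 6 6 (\<lambda>(r, s).
    case (wedge_basis ! r, wedge_basis ! s) of ((i, j), (k, l)) \<Rightarrow>
      A $$ (i, k) * A $$ (j, l) - A $$ (i, l) * A $$ (j, k))"

text \<open>
  Gram matrix of the wedge pairing \<open>\<And>\<^sup>2 k\<^sup>4 \<times> \<And>\<^sup>2 k\<^sup>4 \<rightarrow> \<And>\<^sup>4 k\<^sup>4 = k\<close>, the last identification
  sending \<open>e\<^sub>0 \<and> e\<^sub>1 \<and> e\<^sub>2 \<and> e\<^sub>3\<close> to \<open>1\<close>.
\<close>

definition wedge_pairing :: "'k::field mat" where
  "wedge_pairing = mat_of_rows_list 6
    [[0, 0, 0, 0, 0, 1],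
     [0, 0, 0, 0, -1, 0],
     [0, 0, 0, 1, 0, 0],
     [0, 0, 1, 0, 0, 0],
     [0, -1, 0, 0, 0, 0],
     [1, 0, 0, 0, 0, 0]]"

text \<open>
  \<open>\<pi>\<close> is the map from \<open>SL 4\<close> to \<open>SO 6 Q\<close> obtained from the action on \<open>\<And>\<^sup>2 k\<^sup>4\<close> by means of an
  isometry \<open>P\<close> from \<open>\<And>\<^sup>2 k\<^sup>4\<close> with the wedge pairing to \<open>k\<^sup>6\<close> with the form \<open>Q\<close>.  Over an
  algebraically closed field such a \<open>P\<close> exists for every nondegenerate \<open>Q\<close>.
\<close>

definition spin_cover :: "'k::field mat \<Rightarrow> ('k mat \<Rightarrow> 'k mat) \<Rightarrow> bool" where
  "spin_cover Q \<pi> \<longleftrightarrow>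
    (\<exists>P\<in>carrier (GL 6). transpose_mat P * Q * P = wedge_pairing \<and>
      (\<forall>A\<in>carrier (SL 4). \<pi> A \<in> carrier_mat 6 6 \<and> \<pi> A * P = P * wedge2 A))"

text \<open>
  The extension of \<open>G\<close> given by a surjective homomorphism \<open>\<pi>\<close> from \<open>E\<close> to \<open>G\<close> splits.
\<close>

definition splits ::
  "('e, 'a) monoid_scheme \<Rightarrow> ('e \<Rightarrow> 'g) \<Rightarrow> ('g, 'b) monoid_scheme \<Rightarrow> bool" where
  "splits E \<pi> G \<longleftrightarrow> (\<exists>s\<in>hom G E. \<forall>g\<in>carrier G. \<pi> (s g) = g)"

definition cover_preimage :: "('k::field mat \<Rightarrow> 'k mat) \<Rightarrow> 'k mat set \<Rightarrow> 'k mat set" where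
  "cover_preimage \<pi> G = {A \<in> carrier (SL 4). \<pi> A \<in> G}"

end

theory Submission
  imports Defs
begin

text \<open>
  Write \<open>V = k\<^sup>4\<close>.  The wedge pairing on \<open>\<And>\<^sup>2 V\<close> turns the quadric \<open>X\<close> into the Grassmannian of
  planes in \<open>V\<close>, and a splitting of the extension makes \<open>V\<close> a linear representation of \<open>G\<close> that
  induces the given action on \<open>X\<close>.  A pair of independent vectors of \<open>V\<close> is the same as a plane
  together with a basis of it, so \<open>V \<oplus> V\<close> is birational to the sum of two copies of the tautological
  bundle on \<open>X\<close>.  As \<open>G\<close> acts generically freely on \<open>X\<close>, the no-name lemma trivialises this bundle
  equivariantly, and \<open>\<P>(V \<oplus> V \<oplus> k)\<close> becomes equivariantly birational to \<open>X \<times> \<P>\<^sup>4\<close> with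
  trivial action on the second factor.

  The no-name lemma is made explicit by two equivariant covector fields \<open>L, M\<close> on \<open>X\<close>, homogeneous
  of some degree \<open>e\<close> in the coordinates of \<open>X\<close>, whose restrictions to the plane belonging to a general
  point are a basis of its dual, and by an invariant form \<open>N\<close> of the same degree that balances
  the homogeneity.  With \<open>x = v \<and> w\<close> the map is
  \<open>[v : w : t] \<mapsto> ([x], [L\<^sub>x(v) : L\<^sub>x(w) : M\<^sub>x(v) : M\<^sub>x(w) : t N(x)])\<close>.
  Its target coordinates in \<open>\<P>\<^sup>4\<close> are invariant because \<open>L, M\<close> are equivariant and \<open>N\<close> is invariant.
  The inverse solves, in the plane of \<open>x\<close>, the linear equations that prescribe the values of \<open>L\<^sub>x\<close> and
  \<open>M\<^sub>x\<close>; by Cramer's rule it is again given by forms (\<open>birational_map_forward\<close>).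

  The fields are averages.  Choose a point \<open>x\<^sub>0\<close> of \<open>X\<close> with trivial stabiliser and a form \<open>h\<close> that
  vanishes on its orbit except at \<open>x\<^sub>0\<close> itself (\<open>separating_form\<close>).  Then \<open>\<Sum>\<^sub>g h(g x) (row i of g on V)\<close>
  is an equivariant covector field, and at \<open>x\<^sub>0\<close> only \<open>g = 1\<close> contributes, so that its
  value there is a multiple of the \<open>i\<close>-th coordinate (\<open>avg_covector_equivariant\<close>,
  \<open>avg_at_separated_point\<close>).  Two coordinates that are independent on the plane of \<open>x\<^sub>0\<close>
  give \<open>L\<close> and \<open>M\<close>.
\<close>

section \<open>Homogeneous forms\<close>

text \<open>
  Only the values on \<open>carrier_vec n\<close> matter for projective geometry.  Ignoring the others lets
  operations such as \<open>(*\<^sub>v)\<close> and \<open>(\<bullet>)\<close>, which sum over the actual dimension of their arguments, be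
  used in formulas for forms.
\<close>

definition form :: "nat \<Rightarrow> nat \<Rightarrow> ('k::field vec \<Rightarrow> 'k) \<Rightarrow> bool" where
  "form n d f \<longleftrightarrow> (\<exists>F. hom_poly n d F \<and> (\<forall>v\<in>carrier_vec n. f v = F v))"

definition vec_form :: "nat \<Rightarrow> nat \<Rightarrow> nat \<Rightarrow> ('k::field vec \<Rightarrow> 'k vec) \<Rightarrow> bool" where
  "vec_form n m d F \<longleftrightarrow> (\<forall>v\<in>carrier_vec n. F v \<in> carrier_vec m) \<and> (\<forall>i<m. form n d (\<lambda>v. F v $ i))"

lemma hom_poly_homogeneous:
  assumes "hom_poly n d f" "v \<in> carrier_vec n"
  shows "f (c \<cdot>\<^sub>v v) = c ^ d * f v"
  using assms by induction (auto simp: algebra_simps power_add)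

text \<open>
  Substitution is the closure property from which all explicit degree computations below follow.
\<close>

lemma hom_poly_compose:
  assumes "hom_poly m e f" "\<And>i. i < m \<Longrightarrow> hom_poly n d (F i)"
  shows "hom_poly n (d * e) (\<lambda>v. f (vec m (\<lambda>i. F i v)))"
  using assms(1)
proof induction
  case (mult e1 f e2 g)
  show ?case unfolding distrib_left by (rule hom_poly.mult[OF mult.IH])
qed (use assms(2) in \<open>auto intro: hom_poly.intros\<close>)

lemma formE:
  assumes "form n d f"
  obtains F where "hom_poly n d F" "\<And>v. v \<in> carrier_vec n \<Longrightarrow> f v = F v"
  using assms by (auto simp: form_def)

lemma form_cong:
  assumes "form n d g" "\<And>v. v \<in> carrier_vec n \<Longrightarrow> f v = g v"
  shows "form n d f"
  using assms by (auto simp: form_def)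

lemma form_homogeneous:
  assumes "form n d f" "v \<in> carrier_vec n"
  shows "f (c \<cdot>\<^sub>v v) = c ^ d * f v"
  using assms hom_poly_homogeneous by (force simp: form_def)

lemma form_zero: "form n d (\<lambda>v. 0)"
  unfolding form_def using hom_poly.zero by blast

lemma form_const: "form n 0 (\<lambda>v. c)"
  unfolding form_def using hom_poly.const by blast

lemma form_coord: "i < n \<Longrightarrow> form n 1 (\<lambda>v. v $ i)"
  unfolding form_def using hom_poly.coord by blast

lemma form_add:
  assumes "form n d f" "form n d g"
  shows "form n d (\<lambda>v. f v + g v)"
proof -
  obtain F where "hom_poly n d F" "\<forall>v\<in>carrier_vec n. f v = F v"
    using assms(1) unfolding form_def by blast
  moreover obtain H where "hom_poly n d H" "\<forall>v\<in>carrier_vec n. g v = H v"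
    using assms(2) unfolding form_def by blast
  ultimately show ?thesis
    unfolding form_def by (intro exI[of _ "\<lambda>v. F v + H v"]) (simp add: hom_poly.add)
qed

lemma form_mult:
  assumes "form n d f" "form n e g" "k = d + e"
  shows "form n k (\<lambda>v. f v * g v)"
proof -
  obtain F where "hom_poly n d F" "\<forall>v\<in>carrier_vec n. f v = F v"
    using assms(1) unfolding form_def by blast
  moreover obtain H where "hom_poly n e H" "\<forall>v\<in>carrier_vec n. g v = H v"
    using assms(2) unfolding form_def by blast
  ultimately show ?thesis
    unfolding form_def using assms(3)
    by (intro exI[of _ "\<lambda>v. F v * H v"]) (simp add: hom_poly.mult)
qed

lemma form_scale: "form n d f \<Longrightarrow> form n d (\<lambda>v. c * f v)"
  using form_mult[OF form_const, of n d f d c] by simp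

lemma form_diff: "form n d f \<Longrightarrow> form n d g \<Longrightarrow> form n d (\<lambda>v. f v - g v)"
  using form_add[of n d f "\<lambda>v. (-1) * g v"] form_scale[of n d g "-1"] by simp

lemma form_sum:
  assumes "finite I" "\<And>i. i \<in> I \<Longrightarrow> form n d (f i)"
  shows "form n d (\<lambda>v. \<Sum>i\<in>I. f i v)"
  using assms by induction (auto intro: form_zero form_add)

lemma form_prod:
  assumes "finite I" "\<And>i. i \<in> I \<Longrightarrow> form n (d i) (f i)"
  shows "form n (\<Sum>i\<in>I. d i) (\<lambda>v. \<Prod>i\<in>I. f i v)"
  using assms by induction (auto intro: form_const form_mult[OF _ _ refl])

lemma vec_form_carrier: "vec_form n m d F \<Longrightarrow> v \<in> carrier_vec n \<Longrightarrow> F v \<in> carrier_vec m"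
  by (simp add: vec_form_def)

lemma vec_form_coord: "vec_form n m d F \<Longrightarrow> i < m \<Longrightarrow> form n d (\<lambda>v. F v $ i)"
  by (simp add: vec_form_def)

lemma vec_formI:
  assumes "\<And>i. i < m \<Longrightarrow> form n d (f i)"
    and "\<And>v. v \<in> carrier_vec n \<Longrightarrow> F v = vec m (\<lambda>i. f i v)"
  shows "vec_form n m d F"
  unfolding vec_form_def
proof (intro conjI ballI allI impI)
  show "F v \<in> carrier_vec m" if "v \<in> carrier_vec n" for v
    using assms(2)[OF that] by simp
  show "form n d (\<lambda>v. F v $ i)" if "i < m" for i
    using assms(1)[OF that] by (rule form_cong) (use assms(2) that in simp)
qed

lemma form_compose:
  assumes "form m e f" "vec_form n m d F" "k = d * e"
  shows "form n k (\<lambda>v. f (F v))"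
proof -
  obtain f' where f': "hom_poly m e f'" "\<forall>v\<in>carrier_vec m. f v = f' v"
    using assms(1) unfolding form_def by blast
  have "\<forall>i<m. \<exists>H. hom_poly n d H \<and> (\<forall>v\<in>carrier_vec n. F v $ i = H v)"
    using assms(2) by (auto simp: vec_form_def form_def)
  then obtain H where H: "\<And>i. i < m \<Longrightarrow> hom_poly n d (H i)"
      "\<And>i v. i < m \<Longrightarrow> v \<in> carrier_vec n \<Longrightarrow> F v $ i = H i v"
    by metis
  have "f (F v) = f' (vec m (\<lambda>i. H i v))" if "v \<in> carrier_vec n" for v
  proof -
    have "F v \<in> carrier_vec m"
      using assms(2) that by (rule vec_form_carrier)
    moreover have "F v = vec m (\<lambda>i. H i v)"
      using calculation H(2)[OF _ that] by (intro eq_vecI) auto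
    ultimately show ?thesis using f'(2) by simp
  qed
  moreover have "hom_poly n (d * e) (\<lambda>v. f' (vec m (\<lambda>i. H i v)))"
    using f'(1) H(1) by (rule hom_poly_compose)
  ultimately show ?thesis
    unfolding form_def assms(3) by (intro exI conjI ballI)
qed

lemma vec_form_compose:
  assumes "vec_form m l e F" "vec_form n m d H" "k = d * e"
  shows "vec_form n l k (\<lambda>v. F (H v))"
  unfolding vec_form_def
proof (intro conjI ballI allI impI)
  show "F (H v) \<in> carrier_vec l" if "v \<in> carrier_vec n" for v
    using assms(1,2) that by (intro vec_form_carrier[OF assms(1)] vec_form_carrier[OF assms(2)])
  show "form n k (\<lambda>v. F (H v) $ i)" if "i < l" for i
    using vec_form_coord[OF assms(1) that] assms(2,3) by (rule form_compose)
qed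

lemma vec_form_homogeneous:
  assumes "vec_form n m d F" "v \<in> carrier_vec n"
  shows "F (c \<cdot>\<^sub>v v) = c ^ d \<cdot>\<^sub>v F v"
proof (rule eq_vecI)
  have c: "F v \<in> carrier_vec m" "F (c \<cdot>\<^sub>v v) \<in> carrier_vec m"
    using assms by (auto intro: vec_form_carrier)
  then show "dim_vec (F (c \<cdot>\<^sub>v v)) = dim_vec (c ^ d \<cdot>\<^sub>v F v)" by simp
  show "F (c \<cdot>\<^sub>v v) $ i = (c ^ d \<cdot>\<^sub>v F v) $ i" if "i < dim_vec (c ^ d \<cdot>\<^sub>v F v)" for i
    using that c form_homogeneous[OF vec_form_coord[OF assms(1)] assms(2)] by simp
qed

lemma vec_form_vec:
  assumes "\<And>i. i < m \<Longrightarrow> form n d (f i)"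
  shows "vec_form n m d (\<lambda>v. vec m (\<lambda>i. f i v))"
  using assms by (rule vec_formI) auto

lemma vec_form_id: "vec_form n n 1 (\<lambda>v. v)"
  unfolding vec_form_def using form_coord by blast

lemma vec_form_const: "u \<in> carrier_vec m \<Longrightarrow> vec_form n m 0 (\<lambda>v. u)"
  by (auto simp: vec_form_def intro: form_const)

lemma vec_form_smult:
  assumes "form n d f" "vec_form n m e F" "k = d + e"
  shows "vec_form n m k (\<lambda>v. f v \<cdot>\<^sub>v F v)"
proof (rule vec_formI)
  show "form n k (\<lambda>v. f v * F v $ i)" if "i < m" for i
    using assms that by (auto intro: form_mult vec_form_coord)
  show "f v \<cdot>\<^sub>v F v = vec m (\<lambda>i. f v * F v $ i)" if "v \<in> carrier_vec n" for v
    using vec_form_carrier[OF assms(2) that] by (intro eq_vecI) auto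
qed

lemma vec_form_diff:
  assumes "vec_form n m d F" "vec_form n m d H"
  shows "vec_form n m d (\<lambda>v. F v - H v)"
proof (rule vec_formI)
  show "form n d (\<lambda>v. F v $ i - H v $ i)" if "i < m" for i
    using assms that by (auto intro: form_diff vec_form_coord)
  show "F v - H v = vec m (\<lambda>i. F v $ i - H v $ i)" if "v \<in> carrier_vec n" for v
    using vec_form_carrier[OF assms(1) that] vec_form_carrier[OF assms(2) that]
    by (intro eq_vecI) auto
qed

lemma form_scalar_prod:
  assumes "vec_form n m d F" "vec_form n m e H" "k = d + e"
  shows "form n k (\<lambda>v. F v \<bullet> H v)"
proof (rule form_cong)
  show "form n k (\<lambda>v. \<Sum>i<m. F v $ i * H v $ i)"
    using assms by (intro form_sum) (auto intro: form_mult vec_form_coord)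
  show "F v \<bullet> H v = (\<Sum>i<m. F v $ i * H v $ i)" if "v \<in> carrier_vec n" for v
    using vec_form_carrier[OF assms(2) that] by (auto simp: scalar_prod_def lessThan_atLeast0)
qed

lemma vec_form_mult_mat_vec:
  assumes "A \<in> carrier_mat l m" "vec_form n m d F"
  shows "vec_form n l d (\<lambda>v. A *\<^sub>v F v)"
proof (rule vec_formI)
  show "form n d (\<lambda>v. row A i \<bullet> F v)" if "i < l" for i
    using assms that by (intro form_scalar_prod[where d = 0 and e = d] vec_form_const) auto
  show "A *\<^sub>v F v = vec l (\<lambda>i. row A i \<bullet> F v)" if "v \<in> carrier_vec n" for v
    using assms by (intro eq_vecI) auto
qed

lemma vec_form_append:
  assumes "vec_form n m d F" "vec_form n l d H"
  shows "vec_form n (m + l) d (\<lambda>v. F v @\<^sub>v H v)"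
proof (rule vec_formI)
  show "form n d (\<lambda>v. if i < m then F v $ i else H v $ (i - m))" if "i < m + l" for i
    using that vec_form_coord[OF assms(1), of i] vec_form_coord[OF assms(2), of "i - m"]
    by (cases "i < m") auto
  show "F v @\<^sub>v H v = vec (m + l) (\<lambda>i. if i < m then F v $ i else H v $ (i - m))"
    if "v \<in> carrier_vec n" for v
    using vec_form_carrier[OF assms(1) that] vec_form_carrier[OF assms(2) that]
    by (intro eq_vecI) auto
qed

lemma vec_form_tensor_vec:
  assumes "vec_form n m d F" "vec_form n l e H" "k = d + e"
  shows "vec_form n (m * l) k (\<lambda>v. tensor_vec (F v) (H v))"
proof (rule vec_formI)
  show "form n k (\<lambda>v. F v $ (i div l) * H v $ (i mod l))" if i: "i < m * l" for i
  proof -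
    have "0 < l" using i by (cases l) auto
    then show ?thesis
      using assms i by (intro form_mult[where d = d and e = e])
        (auto intro!: vec_form_coord[of n] simp: less_mult_imp_div_less)
  qed
  show "tensor_vec (F v) (H v) = vec (m * l) (\<lambda>i. F v $ (i div l) * H v $ (i mod l))"
    if "v \<in> carrier_vec n" for v
    using vec_form_carrier[OF assms(1) that] vec_form_carrier[OF assms(2) that]
    by (auto simp: tensor_vec_def)
qed

lemma form_zero_vec:
  fixes f :: "'a::field vec \<Rightarrow> 'a"
  assumes "form n d f" "0 < d"
  shows "f (0\<^sub>v n) = 0"
proof -
  have "0 \<cdot>\<^sub>v 0\<^sub>v n = (0\<^sub>v n :: 'a vec)" by (intro eq_vecI) auto
  then show ?thesis
    using form_homogeneous[OF assms(1), of "0\<^sub>v n" 0] assms(2) by (simp add: power_0_left)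
qed

section \<open>Projective points and Zariski open sets\<close>

lemma mem_proj_point: "v \<in> proj_point v"
  unfolding proj_point_def by (rule CollectI, rule exI[of _ 1]) simp

lemma proj_point_smult:
  assumes "c \<noteq> 0"
  shows "proj_point (c \<cdot>\<^sub>v v) = proj_point v"
proof -
  have "\<exists>b. a \<cdot>\<^sub>v v = b \<cdot>\<^sub>v (c \<cdot>\<^sub>v v) \<and> b \<noteq> 0" if "a \<noteq> 0" for a
    using assms that by (intro exI[of _ "a / c"]) (simp add: smult_smult_assoc)
  then show ?thesis
    using assms by (auto simp: proj_point_def smult_smult_assoc)
qed

lemma proj_pointE:
  assumes "u \<in> proj_point v"
  obtains c where "c \<noteq> 0" "u = c \<cdot>\<^sub>v v"
  using assms by (auto simp: proj_point_def)

lemma proj_point_eqE: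
  assumes "proj_point u = proj_point v"
  obtains c where "c \<noteq> 0" "u = c \<cdot>\<^sub>v v"
  using mem_proj_point[of u] unfolding assms by (elim proj_pointE)

lemma proj_point_in_proj_space [simp]:
  "v \<in> carrier_vec n \<Longrightarrow> v \<noteq> 0\<^sub>v n \<Longrightarrow> proj_point v \<in> proj_space n"
  by (auto simp: proj_space_def)

lemma smult_vec_nonzero:
  fixes v :: "'k::field vec"
  assumes "v \<in> carrier_vec n" "v \<noteq> 0\<^sub>v n" "c \<noteq> 0"
  shows "c \<cdot>\<^sub>v v \<noteq> 0\<^sub>v n"
proof
  assume "c \<cdot>\<^sub>v v = 0\<^sub>v n"
  then have "(1 / c) \<cdot>\<^sub>v (c \<cdot>\<^sub>v v) = (1 / c) \<cdot>\<^sub>v 0\<^sub>v n" by simp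
  also have "(1 / c) \<cdot>\<^sub>v 0\<^sub>v n = 0\<^sub>v n" by (intro eq_vecI) auto
  finally show False using assms by (simp add: smult_smult_assoc)
qed

lemma proj_space_memD:
  assumes "p \<in> proj_space n" "v \<in> p"
  shows "v \<in> carrier_vec n" "v \<noteq> 0\<^sub>v n" "p = proj_point v"
proof -
  obtain u where u: "p = proj_point u" "u \<in> carrier_vec n" "u \<noteq> 0\<^sub>v n"
    using assms(1) by (auto simp: proj_space_def)
  obtain c where c: "c \<noteq> 0" "v = c \<cdot>\<^sub>v u"
    using assms(2) unfolding u(1) by (elim proj_pointE)
  show "v \<in> carrier_vec n" "v \<noteq> 0\<^sub>v n" "p = proj_point v"
    using u c by (auto simp: smult_vec_nonzero proj_point_smult)
qed

lemma proj_space_nonempty: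
  assumes "p \<in> proj_space n"
  obtains v where "v \<in> p"
  using assms mem_proj_point by (auto simp: proj_space_def)

text \<open>
  Homogeneity makes vanishing at a projective point independent of the chosen representative.
\<close>

lemma form_nonzero_on_point_iff:
  assumes "form n d f" "p \<in> proj_space n" "v \<in> p"
  shows "(\<forall>u\<in>p. f u \<noteq> 0) \<longleftrightarrow> f v \<noteq> 0"
proof -
  have "f u \<noteq> 0" if "f v \<noteq> 0" "u \<in> p" for u
    using that proj_space_memD[OF assms(2,3)] form_homogeneous[OF assms(1)]
    by (auto elim!: proj_pointE)
  then show ?thesis using assms(3) by auto
qed

lemma openin_principal_open:
  assumes "form n d f"
  shows "openin (zariski n) (principal_open n f)"
proof -
  obtain F where F: "hom_poly n d F" "\<And>v. v \<in> carrier_vec n \<Longrightarrow> f v = F v"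
    using assms by (elim formE) auto
  have "principal_open n f = principal_open n F"
    using F(2) proj_space_memD(1) unfolding principal_open_def by (metis (mono_tags, lifting))
  then show ?thesis
    using F(1) unfolding zariski_def by (auto intro!: topology_generated_by_Basis)
qed

lemma openin_principal_open_Int:
  "form n d f \<Longrightarrow> openin (zariski_on n X) (principal_open n f \<inter> X)"
  by (auto simp: openin_subtopology intro: openin_principal_open)

lemma openin_zariski_on_subset:
  assumes "openin (zariski_on n X) U"
  shows "U \<subseteq> X"
  using openin_subset[OF assms] by simp

section \<open>Birational maps given by forms\<close>

lemma openin_zariski_on_self:
  assumes "openin (zariski_on n X) U"
  shows "openin (zariski_on n U) U"
proof -
  obtain T where "openin (zariski n) T" "U = T \<inter> X"
    using assms unfolding openin_subtopology by blast
  then show ?thesis unfolding openin_subtopology by blast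
qed

lemma regular_mapI:
  assumes X: "U \<subseteq> proj_space n"
    and cover: "\<And>p. p \<in> U \<Longrightarrow> \<exists>W d F. openin (zariski_on n U) W \<and> p \<in> W \<and> vec_form n m d F \<and>
      (\<forall>q\<in>W. \<forall>v\<in>q. F v \<noteq> 0\<^sub>v m \<and> f q = proj_point (F v))"
  shows "regular_map n m U f"
  unfolding regular_map_def
proof
  fix p assume "p \<in> U"
  then obtain W d F where W: "openin (zariski_on n U) W" "p \<in> W" and F: "vec_form n m d F"
    and eq: "\<And>q v. q \<in> W \<Longrightarrow> v \<in> q \<Longrightarrow> F v \<noteq> 0\<^sub>v m \<and> f q = proj_point (F v)"
    using cover by meson
  have "\<forall>i<m. \<exists>H. hom_poly n d H \<and> (\<forall>v\<in>carrier_vec n. F v $ i = H v)"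
    using F by (auto simp: vec_form_def form_def)
  then obtain H where H: "\<And>i. i < m \<Longrightarrow> hom_poly n d (H i)"
      "\<And>i v. i < m \<Longrightarrow> v \<in> carrier_vec n \<Longrightarrow> F v $ i = H i v"
    by metis
  have "F v = vec m (\<lambda>i. H i v)" if "q \<in> W" "v \<in> q" for q v
  proof -
    have "v \<in> carrier_vec n"
      using that X proj_space_memD(1) openin_zariski_on_subset[OF W(1)] by blast
    then show ?thesis
      using H(2) vec_form_carrier[OF F] by (intro eq_vecI) auto
  qed
  then show "\<exists>W d F. openin (zariski_on n U) W \<and> p \<in> W \<and> (\<forall>j<m. hom_poly n d (F j)) \<and>
      (\<forall>q\<in>W. \<forall>v\<in>q. vec m (\<lambda>j. F j v) \<noteq> 0\<^sub>v m \<and> f q = proj_point (vec m (\<lambda>j. F j v)))"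
    using W H(1) eq by (intro exI[of _ W] exI[of _ d] exI[of _ H]) auto
qed

text \<open>
  For a form-valued \<open>F\<close> all the points in the union coincide; the union avoids choosing a representative.
\<close>

definition proj_map :: "('k::field vec \<Rightarrow> 'k vec) \<Rightarrow> 'k vec set \<Rightarrow> 'k vec set" where
  "proj_map F p = (\<Union>v\<in>p. proj_point (F v))"

lemma proj_map_proj_point:
  assumes "vec_form n m d F" "v \<in> carrier_vec n"
  shows "proj_map F (proj_point v) = proj_point (F v)"
proof -
  have "proj_point (F u) = proj_point (F v)" if u: "u \<in> proj_point v" for u
  proof -
    obtain c where "c \<noteq> 0" "u = c \<cdot>\<^sub>v v" using u by (rule proj_pointE)
    then show ?thesis using vec_form_homogeneous[OF assms, of c] by (simp add: proj_point_smult)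
  qed
  then show ?thesis
    using mem_proj_point[of v] unfolding proj_map_def by blast
qed

text \<open>
  A criterion for birationality that asks for formulas on vectors only.  The map is given by one tuple
  of forms \<open>F\<close>.  Its inverse may need several tuples \<open>H a\<close>, each valid where the form \<open>D a\<close> does not
  vanish, as happens on a Segre product, where no single choice of coordinates works everywhere.
  Both composites only have to be the identity up to a scalar.  The image of \<open>U\<close> is then the union of
  the open sets \<open>D a \<noteq> 0\<close> of \<open>Y\<close>, which gives openness of the image, and regularity of the inverse
  can be checked on each of them.
\<close>

lemma birational_map_of_forms:
  fixes F :: "'k::field vec \<Rightarrow> 'k vec"
  assumes X: "X \<subseteq> proj_space n" and Y: "Y \<subseteq> proj_space m"
    and U: "openin (zariski_on n X) U" "U \<noteq> {}"
    and F: "vec_form n m d F"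
    and D: "\<And>a. a \<in> I \<Longrightarrow> form m (e a) (D a)"
    and H: "\<And>a. a \<in> I \<Longrightarrow> vec_form m n (k a) (H a)"
    and to_Y: "\<And>v. proj_point v \<in> U \<Longrightarrow> F v \<noteq> 0\<^sub>v m \<and> proj_point (F v) \<in> Y"
    and cover: "\<And>v. proj_point v \<in> U \<Longrightarrow> \<exists>a\<in>I. D a (F v) \<noteq> 0"
    and left: "\<And>v a. proj_point v \<in> U \<Longrightarrow> a \<in> I \<Longrightarrow> D a (F v) \<noteq> 0 \<Longrightarrow>
      \<exists>c. c \<noteq> 0 \<and> H a (F v) = c \<cdot>\<^sub>v v"
    and to_X: "\<And>z a. proj_point z \<in> Y \<Longrightarrow> a \<in> I \<Longrightarrow> D a z \<noteq> 0 \<Longrightarrow> proj_point (H a z) \<in> U"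
    and right: "\<And>z a. proj_point z \<in> Y \<Longrightarrow> a \<in> I \<Longrightarrow> D a z \<noteq> 0 \<Longrightarrow>
      \<exists>c. c \<noteq> 0 \<and> F (H a z) = c \<cdot>\<^sub>v z"
  shows "birational_map n X m Y U (proj_map F)"
proof -
  define f where "f = proj_map F"
  define V where "V a = principal_open m (D a) \<inter> Y" for a
  have UX: "U \<subseteq> proj_space n"
    using openin_zariski_on_subset[OF U(1)] X by (rule order_trans)
  note UD = proj_space_memD[OF subsetD[OF UX]]
  have f: "f (proj_point v) = proj_point (F v)" if "proj_point v \<in> U" for v
    unfolding f_def using UD(1)[OF that mem_proj_point] by (rule proj_map_proj_point[OF F])
  have mem_V: "q \<in> V a \<longleftrightarrow> q \<in> Y \<and> D a z \<noteq> 0" if a: "a \<in> I" and z: "z \<in> q" for a q z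
  proof (cases "q \<in> Y")
    case True
    then have q: "q \<in> proj_space m" using Y by blast
    show ?thesis
      unfolding V_def principal_open_def form_nonzero_on_point_iff[OF D[OF a] q z, symmetric]
      using True q by blast
  qed (simp add: V_def)
  have inv: "f (proj_point (H a z)) = q" "proj_point (H a z) \<in> U"
    if a: "a \<in> I" and q_V: "q \<in> V a" and z_q: "z \<in> q" for a q z
  proof -
    have z: "q \<in> Y" "D a z \<noteq> 0" using mem_V[OF a z_q] q_V by auto
    have q: "q = proj_point z" by (rule proj_space_memD(3)[OF subsetD[OF Y z(1)] z_q])
    have zY: "proj_point z \<in> Y" using z(1) unfolding q .
    obtain c where c: "c \<noteq> 0" "F (H a z) = c \<cdot>\<^sub>v z"
      using right[OF zY a z(2)] by blast
    show U': "proj_point (H a z) \<in> U" by (rule to_X[OF zY a z(2)])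
    show "f (proj_point (H a z)) = q"
      unfolding f[OF U'] c(2) q by (rule proj_point_smult[OF c(1)])
  qed
  have image: "f ` U = (\<Union>a\<in>I. V a)"
  proof
    show "f ` U \<subseteq> (\<Union>a\<in>I. V a)"
    proof
      fix q assume "q \<in> f ` U"
      then obtain p where p: "p \<in> U" "q = f p" by blast
      obtain v where v: "v \<in> p" using p(1) UX proj_space_nonempty by blast
      have pv: "p = proj_point v" by (rule UD(3)[OF p(1) v])
      have pU: "proj_point v \<in> U" using p(1) unfolding pv .
      have q: "q = proj_point (F v)" unfolding p(2) pv by (rule f[OF pU])
      obtain a where a: "a \<in> I" "D a (F v) \<noteq> 0" using cover[OF pU] by blast
      have "q \<in> V a"
        unfolding q mem_V[OF a(1) mem_proj_point] using a(2) to_Y[OF pU] by blast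
      then show "q \<in> (\<Union>a\<in>I. V a)" using a by blast
    qed
    show "(\<Union>a\<in>I. V a) \<subseteq> f ` U"
    proof
      fix q assume "q \<in> (\<Union>a\<in>I. V a)"
      then obtain a where a: "a \<in> I" "q \<in> V a" by blast
      then obtain z where z: "z \<in> q"
        using Y proj_space_nonempty by (metis IntD2 V_def subsetD)
      show "q \<in> f ` U" using inv[OF a z] by blast
    qed
  qed
  have inj: "inj_on f U"
  proof (rule inj_onI)
    fix p p' assume p: "p \<in> U" "p' \<in> U" and eq: "f p = f p'"
    obtain v v' where v: "v \<in> p" "v' \<in> p'" using p UX proj_space_nonempty by (metis subsetD)
    have pv: "p = proj_point v" "p' = proj_point v'"
      using UD(3)[OF p(1) v(1)] UD(3)[OF p(2) v(2)] by auto
    have pU: "proj_point v \<in> U" "proj_point v' \<in> U" using p unfolding pv by auto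
    have "proj_point (F v') = proj_point (F v)"
      using eq unfolding pv f[OF pU(1)] f[OF pU(2)] by (rule sym)
    then obtain c where c: "c \<noteq> 0" "F v' = c \<cdot>\<^sub>v F v" by (elim proj_point_eqE)
    obtain a where a: "a \<in> I" "D a (F v) \<noteq> 0" using cover[OF pU(1)] by blast
    have Fv: "F v \<in> carrier_vec m"
      using vec_form_carrier[OF F UD(1)[OF p(1) v(1)]] .
    have "D a (F v') \<noteq> 0"
      using a c form_homogeneous[OF D[OF a(1)] Fv, of c] by simp
    then obtain b' where b': "b' \<noteq> 0" "H a (F v') = b' \<cdot>\<^sub>v v'"
      using left[OF pU(2) a(1)] by blast
    obtain b where b: "b \<noteq> 0" "H a (F v) = b \<cdot>\<^sub>v v"
      using left[OF pU(1) a] by blast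
    have "b' \<cdot>\<^sub>v v' = (c ^ k a * b) \<cdot>\<^sub>v v"
      using vec_form_homogeneous[OF H[OF a(1)] Fv, of c] b b' c by (simp add: smult_smult_assoc)
    then have "proj_point v' = proj_point v"
      using proj_point_smult[OF b'(1), of v'] proj_point_smult[of "c ^ k a * b" v] b(1) c(1) by simp
    then show "p = p'" unfolding pv by (rule sym)
  qed
  have V_open: "openin (zariski_on m Y) (V a)" if "a \<in> I" for a
    unfolding V_def by (rule openin_principal_open_Int[OF D[OF that]])
  have image_open: "openin (zariski_on m Y) (f ` U)"
    unfolding image using V_open by (intro openin_Union) auto
  have regular: "regular_map n m U f"
  proof (rule regular_mapI[OF UX])
    fix p assume p: "p \<in> U"
    have rep: "F v \<noteq> 0\<^sub>v m \<and> f q = proj_point (F v)" if q: "q \<in> U" "v \<in> q" for q v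
    proof -
      have "q = proj_point v" using q by (rule UD(3))
      with q(1) show ?thesis using to_Y[of v] f[of v] by blast
    qed
    show "\<exists>W d F. openin (zariski_on n U) W \<and> p \<in> W \<and> vec_form n m d F \<and>
        (\<forall>q\<in>W. \<forall>v\<in>q. F v \<noteq> 0\<^sub>v m \<and> f q = proj_point (F v))"
      by (rule exI[of _ U], rule exI[of _ d], rule exI[of _ F])
        (intro conjI ballI openin_zariski_on_self[OF U(1)] p F rep)
  qed
  have regular_inv: "regular_map m n (f ` U) (the_inv_into U f)"
  proof (rule regular_mapI)
    show "f ` U \<subseteq> proj_space m" using Y by (auto simp: image V_def)
    fix q assume "q \<in> f ` U"
    then obtain a where a: "a \<in> I" "q \<in> V a" unfolding image by blast
    have "V a = principal_open m (D a) \<inter> f ` U"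
      using a(1) unfolding image by (auto simp: V_def)
    then have V: "openin (zariski_on m (f ` U)) (V a)"
      using openin_principal_open_Int[OF D[OF a(1)]] by simp
    have rep: "H a z \<noteq> 0\<^sub>v n \<and> the_inv_into U f r = proj_point (H a z)"
      if r: "r \<in> V a" "z \<in> r" for r z
    proof
      show "H a z \<noteq> 0\<^sub>v n" using UD(2)[OF inv(2)[OF a(1) r] mem_proj_point] .
      show "the_inv_into U f r = proj_point (H a z)"
        using the_inv_into_f_eq[OF inj inv(1)[OF a(1) r] inv(2)[OF a(1) r]] .
    qed
    show "\<exists>W d F. openin (zariski_on m (f ` U)) W \<and> q \<in> W \<and> vec_form m n d F \<and>
        (\<forall>r\<in>W. \<forall>v\<in>r. F v \<noteq> 0\<^sub>v n \<and> the_inv_into U f r = proj_point (F v))"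
      by (rule exI[of _ "V a"], rule exI[of _ "k a"], rule exI[of _ "H a"])
        (intro conjI ballI V a(2) H[OF a(1)] rep)
  qed
  have "birational_map n X m Y U f"
    unfolding birational_map_def
    using U image_open inj regular regular_inv by (intro conjI)
  then show ?thesis by (simp only: f_def)
qed

section \<open>Alternating tensors on four-space\<close>

definition wedge_vec :: "'k::field vec \<Rightarrow> 'k vec \<Rightarrow> 'k vec" where
  "wedge_vec v w = vec 6 (\<lambda>r. case wedge_basis ! r of (i, j) \<Rightarrow> v $ i * w $ j - v $ j * w $ i)"

text \<open>
  The skew-symmetric matrix of an element of \<open>\<And>\<^sup>2 k\<^sup>4\<close>: for \<open>v \<and> w\<close> it is \<open>v w\<^sup>T - w v\<^sup>T\<close>, and its image is
  the plane spanned by \<open>v\<close> and \<open>w\<close>.  Applying it to a covector is contraction.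
\<close>

definition alt_mat :: "'k::field vec \<Rightarrow> 'k mat" where
  "alt_mat y = mat_of_rows_list 4
    [[0, y $ 0, y $ 1, y $ 2],
     [- y $ 0, 0, y $ 3, y $ 4],
     [- y $ 1, - y $ 3, 0, y $ 5],
     [- y $ 2, - y $ 4, - y $ 5, 0]]"

lemma less_4_cases: "i < 4 \<Longrightarrow> i = 0 \<or> i = 1 \<or> i = 2 \<or> i = (3::nat)"
  by auto

lemma less_6_cases: "i < 6 \<Longrightarrow> i = 0 \<or> i = 1 \<or> i = 2 \<or> i = 3 \<or> i = 4 \<or> i = (5::nat)"
  by auto

lemma sum_lessThan_4: "(\<Sum>i<4. f i) = f 0 + f 1 + f 2 + f (3::nat)"
  by (simp add: numeral_eq_Suc)

lemma sum_lessThan_6: "(\<Sum>i<6. f i) = f 0 + f 1 + f 2 + f 3 + f 4 + f (5::nat)"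
  by (simp add: numeral_eq_Suc)

text \<open>
  The explicit coordinate formulas below are indexed by the numerals \<open>0, 1, 2, \<dots>\<close>, so \<open>1\<close> must not be
  rewritten to \<open>Suc 0\<close>.
\<close>

declare One_nat_def [simp del]

lemma scalar_prod_4: "w \<in> carrier_vec 4 \<Longrightarrow> v \<bullet> w = v $ 0 * w $ 0 + v $ 1 * w $ 1 + v $ 2 * w $ 2 + v $ 3 * w $ 3"
  by (simp add: scalar_prod_def atLeast0LessThan sum_lessThan_4)

lemma scalar_prod_6: "w \<in> carrier_vec 6 \<Longrightarrow>
    v \<bullet> w = v $ 0 * w $ 0 + v $ 1 * w $ 1 + v $ 2 * w $ 2 + v $ 3 * w $ 3 + v $ 4 * w $ 4 + v $ 5 * w $ 5"
  by (simp add: scalar_prod_def atLeast0LessThan sum_lessThan_6)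

lemma wedge_vec_carrier [simp]: "wedge_vec v w \<in> carrier_vec 6" "dim_vec (wedge_vec v w) = 6"
  by (auto simp: wedge_vec_def)

lemma wedge_vec_index:
  "wedge_vec v w $ 0 = v $ 0 * w $ 1 - v $ 1 * w $ 0"
  "wedge_vec v w $ 1 = v $ 0 * w $ 2 - v $ 2 * w $ 0"
  "wedge_vec v w $ 2 = v $ 0 * w $ 3 - v $ 3 * w $ 0"
  "wedge_vec v w $ 3 = v $ 1 * w $ 2 - v $ 2 * w $ 1"
  "wedge_vec v w $ 4 = v $ 1 * w $ 3 - v $ 3 * w $ 1"
  "wedge_vec v w $ 5 = v $ 2 * w $ 3 - v $ 3 * w $ 2"
  by (simp_all add: wedge_vec_def wedge_basis_def)

lemma alt_mat_carrier [simp]: "alt_mat y \<in> carrier_mat 4 4"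
  by (auto simp: alt_mat_def mat_of_rows_list_def)

lemma alt_mat_dim [simp]: "dim_row (alt_mat y) = 4" "dim_col (alt_mat y) = 4"
  by (simp_all add: alt_mat_def mat_of_rows_list_def)

lemma alt_mat_mult_vec_index:
  assumes "l \<in> carrier_vec 4"
  shows "(alt_mat y *\<^sub>v l) $ 0 = y $ 0 * l $ 1 + y $ 1 * l $ 2 + y $ 2 * l $ 3"
    and "(alt_mat y *\<^sub>v l) $ 1 = - y $ 0 * l $ 0 + y $ 3 * l $ 2 + y $ 4 * l $ 3"
    and "(alt_mat y *\<^sub>v l) $ 2 = - y $ 1 * l $ 0 - y $ 3 * l $ 1 + y $ 5 * l $ 3"
    and "(alt_mat y *\<^sub>v l) $ 3 = - y $ 2 * l $ 0 - y $ 4 * l $ 1 - y $ 5 * l $ 2"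
  using assms by (simp_all add: scalar_prod_4 alt_mat_def mat_of_rows_list_def)

lemma alt_mat_mult_vec_carrier [simp]: "alt_mat y *\<^sub>v l \<in> carrier_vec 4"
  by (intro carrier_vecI) simp

text \<open>
  The coordinates of the contraction of \<open>v \<and> w\<close> with a covector.
\<close>

lemma contraction_identities:
  fixes v0 v1 v2 v3 w0 w1 w2 w3 l0 l1 l2 l3 :: "'a::comm_ring_1"
  defines "p \<equiv> l0 * w0 + l1 * w1 + l2 * w2 + l3 * w3" and "q \<equiv> l0 * v0 + l1 * v1 + l2 * v2 + l3 * v3"
  shows "(v0 * w1 - v1 * w0) * l1 + (v0 * w2 - v2 * w0) * l2 + (v0 * w3 - v3 * w0) * l3 = p * v0 - q * w0"
    and "- (v0 * w1 - v1 * w0) * l0 + (v1 * w2 - v2 * w1) * l2 + (v1 * w3 - v3 * w1) * l3 = p * v1 - q * w1"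
    and "- (v0 * w2 - v2 * w0) * l0 - (v1 * w2 - v2 * w1) * l1 + (v2 * w3 - v3 * w2) * l3 = p * v2 - q * w2"
    and "- (v0 * w3 - v3 * w0) * l0 - (v1 * w3 - v3 * w1) * l1 - (v2 * w3 - v3 * w2) * l2 = p * v3 - q * w3"
  unfolding p_def q_def by (simp_all add: algebra_simps)

lemma alt_mat_wedge_vec:
  assumes v: "v \<in> carrier_vec 4" and w: "w \<in> carrier_vec 4" and l: "l \<in> carrier_vec 4"
  shows "alt_mat (wedge_vec v w) *\<^sub>v l = (l \<bullet> w) \<cdot>\<^sub>v v - (l \<bullet> v) \<cdot>\<^sub>v w"
proof (rule eq_vecI)
  fix i assume "i < dim_vec ((l \<bullet> w) \<cdot>\<^sub>v v - (l \<bullet> v) \<cdot>\<^sub>v w)"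
  then have i: "i < 4" using w by simp
  have "(alt_mat (wedge_vec v w) *\<^sub>v l) $ i = (l \<bullet> w) * v $ i - (l \<bullet> v) * w $ i"
    using less_4_cases[OF i]
    by (elim disjE)
      (hypsubst, unfold alt_mat_mult_vec_index[OF l] wedge_vec_index scalar_prod_4[OF v] scalar_prod_4[OF w],
        rule contraction_identities)+
  also have "\<dots> = ((l \<bullet> w) \<cdot>\<^sub>v v - (l \<bullet> v) \<cdot>\<^sub>v w) $ i" using i v w by simp
  finally show "(alt_mat (wedge_vec v w) *\<^sub>v l) $ i = ((l \<bullet> w) \<cdot>\<^sub>v v - (l \<bullet> v) \<cdot>\<^sub>v w) $ i" .
qed (use w in simp)

text \<open>
  The vectors \<open>(a0, a1, a2, a3)\<close> and \<open>(b0, b1, b2, b3)\<close> are the contractions of a tensor \<open>y\<close> with the covectors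
  \<open>l\<close> and \<open>m\<close>.  For every \<open>y\<close> their wedge product is \<open>s y\<close> minus the Pfaffian of \<open>y\<close> times the dual of
  \<open>l \<and> m\<close>, so it is proportional to \<open>y\<close> when the Pfaffian vanishes.
\<close>

lemma pluecker_relations:
  fixes y0 y1 y2 y3 y4 y5 l0 l1 l2 l3 m0 m1 m2 m3 :: "'a::comm_ring_1"
  defines "a0 \<equiv> y0 * l1 + y1 * l2 + y2 * l3" and "b0 \<equiv> y0 * m1 + y1 * m2 + y2 * m3"
    and "a1 \<equiv> - y0 * l0 + y3 * l2 + y4 * l3" and "b1 \<equiv> - y0 * m0 + y3 * m2 + y4 * m3"
    and "a2 \<equiv> - y1 * l0 - y3 * l1 + y5 * l3" and "b2 \<equiv> - y1 * m0 - y3 * m1 + y5 * m3"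
    and "a3 \<equiv> - y2 * l0 - y4 * l1 - y5 * l2" and "b3 \<equiv> - y2 * m0 - y4 * m1 - y5 * m2"
  defines "s \<equiv> l0 * b0 + l1 * b1 + l2 * b2 + l3 * b3"
  assumes pf: "y0 * y5 - y1 * y4 + y2 * y3 = 0"
  shows "a0 * b1 - a1 * b0 = s * y0" and "a0 * b2 - a2 * b0 = s * y1" and "a0 * b3 - a3 * b0 = s * y2"
    and "a1 * b2 - a2 * b1 = s * y3" and "a1 * b3 - a3 * b1 = s * y4" and "a2 * b3 - a3 * b2 = s * y5"
proof -
  note defs = a0_def b0_def a1_def b1_def a2_def b2_def a3_def b3_def s_def
  have "a0 * b1 - a1 * b0 = s * y0 - (y0 * y5 - y1 * y4 + y2 * y3) * (l2 * m3 - l3 * m2)"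
    unfolding defs by (simp add: algebra_simps)
  then show "a0 * b1 - a1 * b0 = s * y0" unfolding pf by simp
  have "a0 * b2 - a2 * b0 = s * y1 - (y0 * y5 - y1 * y4 + y2 * y3) * (l3 * m1 - l1 * m3)"
    unfolding defs by (simp add: algebra_simps)
  then show "a0 * b2 - a2 * b0 = s * y1" unfolding pf by simp
  have "a0 * b3 - a3 * b0 = s * y2 - (y0 * y5 - y1 * y4 + y2 * y3) * (l1 * m2 - l2 * m1)"
    unfolding defs by (simp add: algebra_simps)
  then show "a0 * b3 - a3 * b0 = s * y2" unfolding pf by simp
  have "a1 * b2 - a2 * b1 = s * y3 - (y0 * y5 - y1 * y4 + y2 * y3) * (l0 * m3 - l3 * m0)"
    unfolding defs by (simp add: algebra_simps)
  then show "a1 * b2 - a2 * b1 = s * y3" unfolding pf by simp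
  have "a1 * b3 - a3 * b1 = s * y4 - (y0 * y5 - y1 * y4 + y2 * y3) * (l2 * m0 - l0 * m2)"
    unfolding defs by (simp add: algebra_simps)
  then show "a1 * b3 - a3 * b1 = s * y4" unfolding pf by simp
  have "a2 * b3 - a3 * b2 = s * y5 - (y0 * y5 - y1 * y4 + y2 * y3) * (l0 * m1 - l1 * m0)"
    unfolding defs by (simp add: algebra_simps)
  then show "a2 * b3 - a3 * b2 = s * y5" unfolding pf by simp
qed

text \<open>
  A nonzero tensor with vanishing Pfaffian is decomposable: any two of its contractions that are
  independent span its plane.  This recovers a plane from its point on the quadric.
\<close>

lemma wedge_vec_alt_mat:
  assumes "y \<in> carrier_vec 6" "l \<in> carrier_vec 4" "m \<in> carrier_vec 4"
    and pf: "y $ 0 * y $ 5 - y $ 1 * y $ 4 + y $ 2 * y $ 3 = 0"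
  shows "wedge_vec (alt_mat y *\<^sub>v l) (alt_mat y *\<^sub>v m) = (l \<bullet> (alt_mat y *\<^sub>v m)) \<cdot>\<^sub>v y"
proof (rule eq_vecI)
  fix i assume "i < dim_vec ((l \<bullet> (alt_mat y *\<^sub>v m)) \<cdot>\<^sub>v y)"
  then have i: "i < 6" using assms by simp
  have "wedge_vec (alt_mat y *\<^sub>v l) (alt_mat y *\<^sub>v m) $ i = (l \<bullet> (alt_mat y *\<^sub>v m)) * y $ i"
    using less_6_cases[OF i]
    by (elim disjE)
      (hypsubst, unfold wedge_vec_index scalar_prod_4[OF alt_mat_mult_vec_carrier]
          alt_mat_mult_vec_index[OF assms(2)] alt_mat_mult_vec_index[OF assms(3)],
        rule pluecker_relations[OF pf])+
  then show "wedge_vec (alt_mat y *\<^sub>v l) (alt_mat y *\<^sub>v m) $ i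
      = ((l \<bullet> (alt_mat y *\<^sub>v m)) \<cdot>\<^sub>v y) $ i"
    using i assms(1) by simp
qed (use assms(1) in simp)

lemma wedge2_mult_wedge_vec:
  assumes A: "A \<in> carrier_mat 4 4" and v: "v \<in> carrier_vec 4" and w: "w \<in> carrier_vec 4"
  shows "wedge2 A *\<^sub>v wedge_vec v w = wedge_vec (A *\<^sub>v v) (A *\<^sub>v w)"
proof (rule eq_vecI)
  fix r assume "r < dim_vec (wedge_vec (A *\<^sub>v v) (A *\<^sub>v w))"
  then have r: "r < 6" by simp
  have Av: "(A *\<^sub>v u) $ i = A $$ (i, 0) * u $ 0 + A $$ (i, 1) * u $ 1 + A $$ (i, 2) * u $ 2 + A $$ (i, 3) * u $ 3"
    if "i < 4" "u \<in> carrier_vec 4" for i u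
    using A that by (simp add: scalar_prod_4)
  have "(wedge2 A *\<^sub>v wedge_vec v w) $ r = (\<Sum>s<6. wedge2 A $$ (r, s) * wedge_vec v w $ s)"
    using r by (simp add: wedge2_def scalar_prod_def atLeast0LessThan)
  also have "\<dots> = wedge_vec (A *\<^sub>v v) (A *\<^sub>v w) $ r"
    using less_6_cases[OF r] 
    by (elim disjE; simp only:; simp add: sum_lessThan_6 wedge2_def wedge_basis_def wedge_vec_index Av v w del: index_mult_mat_vec; simp add: algebra_simps)
  finally show "(wedge2 A *\<^sub>v wedge_vec v w) $ r = wedge_vec (A *\<^sub>v v) (A *\<^sub>v w) $ r" .
qed (auto simp: wedge2_def)

text \<open>
  The quadratic form of the wedge pairing is twice the Pfaffian, so its quadric is the Grassmannian.
\<close>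

lemma quad_form_wedge_pairing:
  fixes y :: "'k::field vec"
  assumes "y \<in> carrier_vec 6"
  shows "quad_form wedge_pairing y = 2 * (y $ 0 * y $ 5 - y $ 1 * y $ 4 + y $ 2 * y $ 3)"
proof -
  have c: "wedge_pairing *\<^sub>v y \<in> carrier_vec 6"
    by (intro carrier_vecI) (simp add: wedge_pairing_def mat_of_rows_list_def)
  have e: "(wedge_pairing *\<^sub>v y) $ 0 = y $ 5" "(wedge_pairing *\<^sub>v y) $ 1 = - y $ 4"
    "(wedge_pairing *\<^sub>v y) $ 2 = y $ 3" "(wedge_pairing *\<^sub>v y) $ 3 = y $ 2"
    "(wedge_pairing *\<^sub>v y) $ 4 = - y $ 1" "(wedge_pairing *\<^sub>v y) $ 5 = y $ 0"
    by (simp_all add: wedge_pairing_def mat_of_rows_list_def scalar_prod_6[OF assms])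
  have "y0 * y5 + y1 * - y4 + y2 * y3 + y3 * y2 + y4 * - y1 + y5 * y0
      = 2 * (y0 * y5 - y1 * y4 + y2 * y3)" for y0 y1 y2 y3 y4 y5 :: 'k
    by (simp add: algebra_simps)
  then show ?thesis
    unfolding quad_form_def scalar_prod_6[OF c] e .
qed

lemma pfaffian_wedge_vec:
  "wedge_vec v w $ 0 * wedge_vec v w $ 5 - wedge_vec v w $ 1 * wedge_vec v w $ 4
    + wedge_vec v w $ 2 * wedge_vec v w $ 3 = 0"
  by (simp add: wedge_vec_index algebra_simps)

lemma wedge_vec_smult:
  assumes "v \<in> carrier_vec 4" "w \<in> carrier_vec 4"
  shows "wedge_vec (a \<cdot>\<^sub>v v) (b \<cdot>\<^sub>v w) = (a * b) \<cdot>\<^sub>v wedge_vec v w"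
proof (rule eq_vecI)
  fix i assume "i < dim_vec ((a * b) \<cdot>\<^sub>v wedge_vec v w)"
  then have i: "i < 6" by simp
  show "wedge_vec (a \<cdot>\<^sub>v v) (b \<cdot>\<^sub>v w) $ i = ((a * b) \<cdot>\<^sub>v wedge_vec v w) $ i"
    using less_6_cases[OF i] assms by (elim disjE; simp only:; simp add: wedge_vec_index algebra_simps)
qed simp

lemma wedge_vec_combination:
  assumes "v \<in> carrier_vec 4" "w \<in> carrier_vec 4"
  shows "wedge_vec (c \<cdot>\<^sub>v v - a \<cdot>\<^sub>v w) (d \<cdot>\<^sub>v v - b \<cdot>\<^sub>v w) = (a * d - b * c) \<cdot>\<^sub>v wedge_vec v w"
proof (rule eq_vecI)
  fix i assume "i < dim_vec ((a * d - b * c) \<cdot>\<^sub>v wedge_vec v w)"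
  then have i: "i < 6" by simp
  show "wedge_vec (c \<cdot>\<^sub>v v - a \<cdot>\<^sub>v w) (d \<cdot>\<^sub>v v - b \<cdot>\<^sub>v w) $ i = ((a * d - b * c) \<cdot>\<^sub>v wedge_vec v w) $ i"
    using less_6_cases[OF i] assms by (elim disjE; simp only:; simp add: wedge_vec_index algebra_simps)
qed simp

lemma scalar_prod_alt_mat_self:
  assumes "l \<in> carrier_vec 4"
  shows "l \<bullet> (alt_mat y *\<^sub>v l) = 0"
  using assms by (simp add: scalar_prod_4 alt_mat_mult_vec_index algebra_simps del: index_mult_mat_vec)

lemma scalar_prod_alt_mat_swap:
  assumes "l \<in> carrier_vec 4" "m \<in> carrier_vec 4"
  shows "l \<bullet> (alt_mat y *\<^sub>v m) = - (m \<bullet> (alt_mat y *\<^sub>v l))"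
  using assms by (simp add: scalar_prod_4 alt_mat_mult_vec_index algebra_simps del: index_mult_mat_vec)

text \<open>
  If \<open>y\<close> is decomposable, the coordinate functions \<open>i\<close> and \<open>j\<close> are independent on its plane.
\<close>

lemma alt_mat_entry_nonzero:
  assumes "y \<in> carrier_vec 6" "y \<noteq> 0\<^sub>v 6"
  obtains i j where "i < 4" "j < 4" "unit_vec 4 i \<bullet> (alt_mat y *\<^sub>v unit_vec 4 j) \<noteq> 0"
proof -
  have e: "unit_vec 4 i \<bullet> (alt_mat y *\<^sub>v unit_vec 4 j) = alt_mat y $$ (i, j)" if "i < 4" "j < 4" for i j
    using that by (simp add: scalar_prod_left_unit[where n = 4])
  have "\<exists>r<6. y $ r \<noteq> 0"
  proof (rule ccontr)
    assume "\<not> (\<exists>r<6. y $ r \<noteq> 0)"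
    then have "y = 0\<^sub>v 6" using assms(1) by (intro eq_vecI) auto
    then show False using assms(2) by contradiction
  qed
  then obtain r where r: "r < 6" "y $ r \<noteq> 0" by blast
  have "\<exists>i j. i < 4 \<and> j < 4 \<and> alt_mat y $$ (i, j) = y $ r"
  proof (intro exI conjI)
    show "fst (wedge_basis ! r) < 4" "snd (wedge_basis ! r) < 4"
      using less_6_cases[OF r(1)] by (auto simp: wedge_basis_def)
    show "alt_mat y $$ (fst (wedge_basis ! r), snd (wedge_basis ! r)) = y $ r"
      using less_6_cases[OF r(1)] by (elim disjE) (simp_all add: alt_mat_def mat_of_rows_list_def wedge_basis_def)
  qed
  then obtain i j where ij: "i < 4" "j < 4" "alt_mat y $$ (i, j) = y $ r" by blast
  show ?thesis
    using r(2) unfolding ij(3)[symmetric] e[OF ij(1,2), symmetric] by (rule that[OF ij(1,2)])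
qed

declare One_nat_def [simp]

section \<open>The Segre embedding\<close>

text \<open>
  The columns and rows of the matrix \<open>z\<close> of a point in Segre coordinates.  For \<open>z = v \<otimes> w\<close> they are multiples of
  \<open>v\<close> and of \<open>w\<close>, so they invert the Segre embedding wherever they do not vanish.
\<close>

definition tensor_col :: "nat \<Rightarrow> nat \<Rightarrow> 'k::field vec \<Rightarrow> nat \<Rightarrow> 'k vec" where
  "tensor_col n m z j = vec n (\<lambda>i. z $ (i * m + j))"

definition tensor_row :: "nat \<Rightarrow> 'k::field vec \<Rightarrow> nat \<Rightarrow> 'k vec" where
  "tensor_row m z i = vec m (\<lambda>j. z $ (i * m + j))"

lemma tensor_index_less:
  assumes "i < n" "j < (m::nat)"
  shows "i * m + j < n * m"
proof -
  have "i * m + j < Suc i * m" using assms(2) by simp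
  also have "\<dots> \<le> n * m" using assms(1) by (intro mult_le_mono1) simp
  finally show ?thesis .
qed

lemma tensor_vec_carrier [simp]:
  "v \<in> carrier_vec n \<Longrightarrow> w \<in> carrier_vec m \<Longrightarrow> tensor_vec v w \<in> carrier_vec (n * m)"
  by (intro carrier_vecI) (simp add: tensor_vec_def)

lemma tensor_vec_index:
  assumes "v \<in> carrier_vec n" "w \<in> carrier_vec m" "i < n" "j < m"
  shows "tensor_vec v w $ (i * m + j) = v $ i * w $ j"
  using assms tensor_index_less[OF assms(3,4)] by (simp add: tensor_vec_def)

lemma tensor_col_tensor_vec:
  assumes "v \<in> carrier_vec n" "w \<in> carrier_vec m" "j < m"
  shows "tensor_col n m (tensor_vec v w) j = w $ j \<cdot>\<^sub>v v"
  using assms by (intro eq_vecI) (auto simp: tensor_col_def tensor_vec_index)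

lemma tensor_row_tensor_vec:
  assumes "v \<in> carrier_vec n" "w \<in> carrier_vec m" "i < n"
  shows "tensor_row m (tensor_vec v w) i = v $ i \<cdot>\<^sub>v w"
  using assms by (intro eq_vecI) (auto simp: tensor_row_def tensor_vec_index)

lemma vec_form_tensor_col: "j < m \<Longrightarrow> vec_form (n * m) n 1 (\<lambda>z. tensor_col n m z j)"
  unfolding tensor_col_def by (intro vec_form_vec form_coord tensor_index_less)

lemma vec_form_tensor_row: "i < n \<Longrightarrow> vec_form (n * m) m 1 (\<lambda>z. tensor_row m z i)"
  unfolding tensor_row_def by (intro vec_form_vec form_coord tensor_index_less)

lemma tensor_vec_smult:
  assumes "v \<in> carrier_vec n" "w \<in> carrier_vec m"
  shows "tensor_vec (a \<cdot>\<^sub>v v) (b \<cdot>\<^sub>v w) = (a * b) \<cdot>\<^sub>v tensor_vec v w"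
proof (rule eq_vecI)
  fix i assume "i < dim_vec ((a * b) \<cdot>\<^sub>v tensor_vec v w)"
  then have i: "i < n * m" using tensor_vec_carrier[OF assms] by simp
  then have "0 < m" by (cases m) auto
  then have "i div m < n" "i mod m < m" using i by (auto simp: less_mult_imp_div_less)
  then show "tensor_vec (a \<cdot>\<^sub>v v) (b \<cdot>\<^sub>v w) $ i = ((a * b) \<cdot>\<^sub>v tensor_vec v w) $ i"
    using i assms by (simp add: tensor_vec_def)
qed (simp add: tensor_vec_def)

lemma nonzero_vec_index:
  assumes "v \<in> carrier_vec n" "v \<noteq> 0\<^sub>v n"
  obtains i where "i < n" "v $ i \<noteq> 0"
proof -
  have "\<exists>i<n. v $ i \<noteq> 0"
  proof (rule ccontr)
    assume "\<not> (\<exists>i<n. v $ i \<noteq> 0)"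
    then have "v = 0\<^sub>v n" using assms(1) by (intro eq_vecI) auto
    then show False using assms(2) by contradiction
  qed
  then show ?thesis using that by blast
qed

lemma tensor_vec_nonzero:
  assumes "v \<in> carrier_vec n" "v \<noteq> 0\<^sub>v n" "w \<in> carrier_vec m" "w \<noteq> 0\<^sub>v m"
  shows "tensor_vec v w \<noteq> 0\<^sub>v (n * m)"
proof
  assume z: "tensor_vec v w = 0\<^sub>v (n * m)"
  obtain i where i: "i < n" "v $ i \<noteq> 0" using assms(1,2) by (rule nonzero_vec_index)
  obtain j where j: "j < m" "w $ j \<noteq> 0" using assms(3,4) by (rule nonzero_vec_index)
  have "v $ i * w $ j = 0"
    using tensor_vec_index[OF assms(1,3) i(1) j(1)] tensor_index_less[OF i(1) j(1)] unfolding z by simp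
  then show False using i(2) j(2) by simp
qed

lemma segre_proj_point:
  assumes "v \<in> carrier_vec n" "w \<in> carrier_vec m"
  shows "segre (proj_point v) (proj_point w) = proj_point (tensor_vec v w)"
proof
  show "segre (proj_point v) (proj_point w) \<subseteq> proj_point (tensor_vec v w)"
  proof
    fix z assume "z \<in> segre (proj_point v) (proj_point w)"
    then obtain a b where "a \<noteq> 0" "b \<noteq> 0" "z = tensor_vec (a \<cdot>\<^sub>v v) (b \<cdot>\<^sub>v w)"
      unfolding segre_def proj_point_def by blast
    then show "z \<in> proj_point (tensor_vec v w)"
      unfolding tensor_vec_smult[OF assms] proj_point_def by (intro CollectI exI[of _ "a * b"]) simp
  qed
  show "proj_point (tensor_vec v w) \<subseteq> segre (proj_point v) (proj_point w)"
  proof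
    fix z assume "z \<in> proj_point (tensor_vec v w)"
    then obtain c where c: "c \<noteq> 0" "z = c \<cdot>\<^sub>v tensor_vec v w" by (rule proj_pointE)
    have "z = tensor_vec (c \<cdot>\<^sub>v v) w"
      using tensor_vec_smult[OF assms, of c 1] c(2) by simp
    moreover have "c \<cdot>\<^sub>v v \<in> proj_point v" using c(1) unfolding proj_point_def by blast
    ultimately show "z \<in> segre (proj_point v) (proj_point w)"
      unfolding segre_def using mem_proj_point by blast
  qed
qed

lemma segre_in_proj_space:
  assumes "p \<in> proj_space n" "q \<in> proj_space m"
  shows "segre p q \<in> proj_space (n * m)"
proof -
  obtain v w where vw: "v \<in> p" "w \<in> q" using assms proj_space_nonempty by metis
  note v = proj_space_memD[OF assms(1) vw(1)] and w = proj_space_memD[OF assms(2) vw(2)]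
  show ?thesis
    unfolding v(3) w(3) segre_proj_point[OF v(1) w(1)]
    using tensor_vec_nonzero[OF v(1,2) w(1,2)] v(1) w(1) by (intro proj_point_in_proj_space) auto
qed

lemma prod_variety_subset:
  assumes "X \<subseteq> proj_space n" "Y \<subseteq> proj_space m"
  shows "prod_variety X Y \<subseteq> proj_space (n * m)"
  unfolding prod_variety_def using assms segre_in_proj_space by blast

lemma inj_on_segre:
  fixes X Y :: "'a::field vec set set"
  assumes "X \<subseteq> proj_space n" "Y \<subseteq> proj_space m"
  shows "inj_on (\<lambda>(p, q). segre p q) (X \<times> Y)"
proof (rule inj_onI)
  fix a b :: "'a vec set \<times> 'a vec set"
  assume a: "a \<in> X \<times> Y" and b: "b \<in> X \<times> Y"
    and eq: "(case a of (p, q) \<Rightarrow> segre p q) = (case b of (p, q) \<Rightarrow> segre p q)"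
  obtain p q p' q' where ab: "a = (p, q)" "b = (p', q')" by (metis prod.collapse)
  have mem: "p \<in> proj_space n" "q \<in> proj_space m" "p' \<in> proj_space n" "q' \<in> proj_space m"
    using a b assms unfolding ab by auto
  have s: "segre p q = segre p' q'" using eq unfolding ab by simp
  obtain v where v: "v \<in> p" using mem(1) by (rule proj_space_nonempty)
  obtain w where w: "w \<in> q" using mem(2) by (rule proj_space_nonempty)
  have "tensor_vec v w \<in> segre p q"
    unfolding segre_def using v w by blast
  then have "tensor_vec v w \<in> segre p' q'"
    unfolding s .
  then obtain v' w' where vw': "v' \<in> p'" "w' \<in> q'" and t: "tensor_vec v w = tensor_vec v' w'"
    unfolding segre_def by blast
  note v = proj_space_memD[OF mem(1) v] and w = proj_space_memD[OF mem(2) w]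
    and v' = proj_space_memD[OF mem(3) vw'(1)] and w' = proj_space_memD[OF mem(4) vw'(2)]
  obtain i where i: "i < n" "v $ i \<noteq> 0" using v(1,2) by (rule nonzero_vec_index)
  obtain j where j: "j < m" "w $ j \<noteq> 0" using w(1,2) by (rule nonzero_vec_index)
  have ij: "v' $ i * w' $ j \<noteq> 0"
    using i(2) j(2) tensor_vec_index[OF v(1) w(1) i(1) j(1)] tensor_vec_index[OF v'(1) w'(1) i(1) j(1)]
    unfolding t by simp
  have vv: "w $ j \<cdot>\<^sub>v v = w' $ j \<cdot>\<^sub>v v'"
    using tensor_col_tensor_vec[OF v(1) w(1) j(1)] tensor_col_tensor_vec[OF v'(1) w'(1) j(1)]
    unfolding t by (rule trans[OF sym])
  have nz: "w' $ j \<noteq> 0" "v' $ i \<noteq> 0" using ij by auto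
  from vv have "proj_point v = proj_point v'"
    unfolding proj_point_smult[OF j(2), of v, symmetric] proj_point_smult[OF nz(1), of v', symmetric]
    by (rule arg_cong)
  then have p: "p = p'" unfolding v(3)[symmetric] v'(3)[symmetric] .
  have "v $ i \<cdot>\<^sub>v w = v' $ i \<cdot>\<^sub>v w'"
    using tensor_row_tensor_vec[OF v(1) w(1) i(1)] tensor_row_tensor_vec[OF v'(1) w'(1) i(1)]
    unfolding t by (rule trans[OF sym])
  then have "proj_point w = proj_point w'"
    unfolding proj_point_smult[OF i(2), of w, symmetric] proj_point_smult[OF nz(2), of w', symmetric]
    by (rule arg_cong)
  then have "q = q'" unfolding w(3)[symmetric] w'(3)[symmetric] .
  with p show "a = b" unfolding ab by simp
qed

lemma prod_action_segre:
  assumes "X \<subseteq> proj_space n" "Y \<subseteq> proj_space m" "p \<in> X" "q \<in> Y"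
  shows "prod_action X Y act g (segre p q) = segre (act g p) q"
  using the_inv_into_f_f[OF inj_on_segre[OF assms(1,2)], of "(p, q)"] assms(3,4)
  by (simp add: prod_action_def)

section \<open>Points of the quadric\<close>

lemma quad_form_smult:
  assumes "Q \<in> carrier_mat n n" "x \<in> carrier_vec n"
  shows "quad_form Q (c \<cdot>\<^sub>v x) = c * c * quad_form Q x"
  unfolding quad_form_def mult_mat_vec[OF assms] using assms by simp

lemma quadric_subset: "quadric n Q \<subseteq> proj_space n"
  by (simp add: quadric_def)

lemma proj_point_in_quadric_iff:
  assumes Q: "Q \<in> carrier_mat n n" and x: "x \<in> carrier_vec n" "x \<noteq> 0\<^sub>v n"
  shows "proj_point x \<in> quadric n Q \<longleftrightarrow> quad_form Q x = 0"
proof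
  show "quad_form Q x = 0" if "proj_point x \<in> quadric n Q"
    using that mem_proj_point unfolding quadric_def by blast
  assume zero: "quad_form Q x = 0"
  have "quad_form Q u = 0" if u: "u \<in> proj_point x" for u
  proof -
    obtain c where "u = c \<cdot>\<^sub>v x" using u by (rule proj_pointE)
    then show ?thesis using quad_form_smult[OF Q x(1)] zero by simp
  qed
  then show "proj_point x \<in> quadric n Q"
    unfolding quadric_def using proj_point_in_proj_space[OF x] by blast
qed

lemma prod_variety_quadricE:
  assumes Q: "Q \<in> carrier_mat n n" and z: "proj_point z \<in> prod_variety (quadric n Q) (proj_space m)"
  obtains x y where "z = tensor_vec x y" "x \<in> carrier_vec n" "quad_form Q x = 0" "y \<in> carrier_vec m"
proof -
  obtain p q where pq: "p \<in> quadric n Q" "q \<in> proj_space m" "proj_point z = segre p q"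
    using z unfolding prod_variety_def by blast
  have "z \<in> segre p q" using mem_proj_point[of z] unfolding pq(3) .
  then obtain x y where xy: "z = tensor_vec x y" "x \<in> p" "y \<in> q"
    unfolding segre_def by blast
  have p: "p \<in> proj_space n" using pq(1) quadric_subset by blast
  have "quad_form Q x = 0" using pq(1) xy(2) unfolding quadric_def by blast
  with xy(1) show ?thesis
    using proj_space_memD(1)[OF p xy(2)] proj_space_memD(1)[OF pq(2) xy(3)] by (intro that)
qed

section \<open>Pairs of vectors in four-space\<close>

text \<open>
  The space \<open>k\<^sup>4 \<oplus> k\<^sup>4 \<oplus> k\<close>; the last summand only serves to compactify the sum of the first two.
\<close>

definition pair_vec :: "'k::field vec \<Rightarrow> 'k vec \<Rightarrow> 'k \<Rightarrow> 'k vec" where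
  "pair_vec v w t = (v @\<^sub>v w) @\<^sub>v vec 1 (\<lambda>_. t)"

definition fst_vec :: "'k::field vec \<Rightarrow> 'k vec" where
  "fst_vec u = vec 4 (\<lambda>i. u $ i)"

definition snd_vec :: "'k::field vec \<Rightarrow> 'k vec" where
  "snd_vec u = vec 4 (\<lambda>i. u $ (4 + i))"

lemma fst_snd_vec_carrier [simp]: "fst_vec u \<in> carrier_vec 4" "snd_vec u \<in> carrier_vec 4"
  by (simp_all add: fst_vec_def snd_vec_def)

lemma pair_vec_carrier [simp]:
  assumes "v \<in> carrier_vec 4" "w \<in> carrier_vec 4"
  shows "pair_vec v w t \<in> carrier_vec 9"
  using assms by (intro carrier_vecI) (simp add: pair_vec_def)

lemma pair_vec_components:
  assumes "v \<in> carrier_vec 4" "w \<in> carrier_vec 4"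
  shows "fst_vec (pair_vec v w t) = v" "snd_vec (pair_vec v w t) = w" "pair_vec v w t $ 8 = t"
  using assms by (auto simp: fst_vec_def snd_vec_def pair_vec_def intro!: eq_vecI)

lemma pair_vec_fst_snd:
  assumes "u \<in> carrier_vec 9"
  shows "pair_vec (fst_vec u) (snd_vec u) (u $ 8) = u"
proof (rule eq_vecI)
  fix i assume "i < dim_vec u"
  then have i: "i < 9" using assms by simp
  then have "i < 4 \<or> (4 \<le> i \<and> i < 8) \<or> i = 8" by auto
  then show "pair_vec (fst_vec u) (snd_vec u) (u $ 8) $ i = u $ i"
    by (elim disjE) (auto simp: pair_vec_def fst_vec_def snd_vec_def)
qed (use assms in \<open>simp add: pair_vec_def fst_vec_def snd_vec_def\<close>)

lemma pair_vec_smult: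
  assumes "v \<in> carrier_vec 4" "w \<in> carrier_vec 4"
  shows "pair_vec (c \<cdot>\<^sub>v v) (c \<cdot>\<^sub>v w) (c * t) = c \<cdot>\<^sub>v pair_vec v w t"
  using assms by (intro eq_vecI) (auto simp: pair_vec_def)

lemma vec_form_pair_vec:
  assumes "vec_form n 4 d F" "vec_form n 4 d H" "form n d f"
  shows "vec_form n 9 d (\<lambda>v. pair_vec (F v) (H v) (f v))"
proof -
  have "vec_form n (4 + 4 + 1) d (\<lambda>v. pair_vec (F v) (H v) (f v))"
    unfolding pair_vec_def using assms by (intro vec_form_append vec_form_vec)
  then show ?thesis by simp
qed

lemma vec_form_fst_vec: "vec_form 9 4 1 fst_vec"
  unfolding fst_vec_def[abs_def] by (intro vec_form_vec form_coord) simp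

lemma vec_form_snd_vec: "vec_form 9 4 1 snd_vec"
  unfolding snd_vec_def[abs_def] by (intro vec_form_vec form_coord) simp

lemma vec_form_wedge_vec:
  assumes F: "vec_form n 4 d F" and H: "vec_form n 4 e H"
  shows "vec_form n 6 (d + e) (\<lambda>v. wedge_vec (F v) (H v))"
proof -
  have "form n (d + e) (\<lambda>v. case wedge_basis ! r of (i, j) \<Rightarrow> F v $ i * H v $ j - F v $ j * H v $ i)"
    if r: "r < 6" for r
  proof -
    have "fst (wedge_basis ! r) < 4" "snd (wedge_basis ! r) < 4"
      using less_6_cases[OF r] by (auto simp: wedge_basis_def)
    then show ?thesis
      unfolding split_beta by (intro form_diff form_mult[OF vec_form_coord[OF F] vec_form_coord[OF H] refl])
  qed
  then show ?thesis unfolding wedge_vec_def by (rule vec_form_vec)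
qed

lemma vec_form_alt_mat:
  assumes Y: "vec_form n 6 d Y" and F: "vec_form n 4 e F" and k: "k = d + e"
  shows "vec_form n 4 k (\<lambda>v. alt_mat (Y v) *\<^sub>v F v)"
proof (rule vec_formI)
  have entry: "form n d (\<lambda>v. alt_mat (Y v) $$ (i, j))" if "i < 4" "j < 4" for i j
  proof -
    have minus: "form n d (\<lambda>v. - f v)" if "form n d f" for f
      using form_scale[OF that, of "-1"] by simp
    show ?thesis
      using less_4_cases[OF that(1)] less_4_cases[OF that(2)]
      by (elim disjE) (simp_all add: alt_mat_def mat_of_rows_list_def form_zero minus vec_form_coord[OF Y])
  qed
  show "form n k (\<lambda>v. \<Sum>j<4. alt_mat (Y v) $$ (i, j) * F v $ j)" if "i < 4" for i
    by (intro form_sum form_mult[OF entry[OF that] vec_form_coord[OF F] k]) auto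
  show "alt_mat (Y v) *\<^sub>v F v = vec 4 (\<lambda>i. \<Sum>j<4. alt_mat (Y v) $$ (i, j) * F v $ j)"
    if "v \<in> carrier_vec n" for v
  proof (rule eq_vecI)
    show "(alt_mat (Y v) *\<^sub>v F v) $ i = vec 4 (\<lambda>i. \<Sum>j<4. alt_mat (Y v) $$ (i, j) * F v $ j) $ i"
      if i: "i < dim_vec (vec 4 (\<lambda>i. \<Sum>j<4. alt_mat (Y v) $$ (i, j) * F v $ j))" for i
      using i vec_form_carrier[OF F \<open>v \<in> carrier_vec n\<close>]
      by (simp add: scalar_prod_def atLeast0LessThan)
  qed simp
qed

text \<open>
  Cramer's rule in a plane with basis \<open>v\<close>, \<open>w\<close>: if two covectors take the values \<open>a\<close>, \<open>c\<close> on \<open>v\<close> and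
  \<open>b\<close>, \<open>d\<close> on \<open>w\<close>, the contractions of \<open>v \<and> w\<close> with them are \<open>b v - a w\<close> and \<open>d v - c w\<close>, and
  \<open>v\<close> and \<open>w\<close> are recovered from these up to the determinant.
\<close>

lemma elimination:
  fixes v w :: "'k::field vec"
  assumes "v \<in> carrier_vec n" "w \<in> carrier_vec n"
  shows "c \<cdot>\<^sub>v (b \<cdot>\<^sub>v v - a \<cdot>\<^sub>v w) - a \<cdot>\<^sub>v (d \<cdot>\<^sub>v v - c \<cdot>\<^sub>v w) = (b * c - a * d) \<cdot>\<^sub>v v"
    and "d \<cdot>\<^sub>v (b \<cdot>\<^sub>v v - a \<cdot>\<^sub>v w) - b \<cdot>\<^sub>v (d \<cdot>\<^sub>v v - c \<cdot>\<^sub>v w) = (b * c - a * d) \<cdot>\<^sub>v w"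
  using assms by (auto intro!: eq_vecI simp: algebra_simps)

section \<open>The birational map from framed pairs\<close>

text \<open>
  The matrix \<open>P\<close> identifies \<open>\<And>\<^sup>2 k\<^sup>4\<close> with the space of the form \<open>Q\<close>.  The maps \<open>L\<close>, \<open>M\<close> attach covectors
  on \<open>k\<^sup>4\<close> to points of the quadric and serve as a coordinate system on the corresponding planes; \<open>N\<close> has the
  same degree, so the five entries of \<open>coords\<close> below have one common degree.
\<close>

locale framed_quadric =
  fixes Q P P' :: "'k::field_char_0 mat" and e :: nat
    and L M :: "'k vec \<Rightarrow> 'k vec" and N :: "'k vec \<Rightarrow> 'k"
  assumes Q: "Q \<in> carrier_mat 6 6" and P: "P \<in> carrier_mat 6 6" and P': "P' \<in> carrier_mat 6 6"
    and PP': "P * P' = 1\<^sub>m 6" and P'P: "P' * P = 1\<^sub>m 6"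
    and isometry: "transpose_mat P * Q * P = wedge_pairing"
    and L: "vec_form 6 4 e L" and M: "vec_form 6 4 e M" and N: "form 6 e N"
begin

definition span_point :: "'k vec \<Rightarrow> 'k vec \<Rightarrow> 'k vec" where
  "span_point v w = P *\<^sub>v wedge_vec v w"

text \<open>
  At a point \<open>x\<close> of the quadric the contractions with all covectors \<open>l\<close> fill the plane represented by \<open>x\<close>.
\<close>

definition contract :: "'k vec \<Rightarrow> 'k vec \<Rightarrow> 'k vec" where
  "contract x l = alt_mat (P' *\<^sub>v x) *\<^sub>v l"

text \<open>
  If \<open>x\<close> represents \<open>v \<and> w\<close>, this is up to sign the determinant of the values of \<open>L x\<close> and \<open>M x\<close> on \<open>v\<close> and \<open>w\<close>.
\<close>

definition \<delta> :: "'k vec \<Rightarrow> 'k" where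
  "\<delta> x = M x \<bullet> contract x (L x)"

definition point :: "'k vec \<Rightarrow> 'k vec" where
  "point u = span_point (fst_vec u) (snd_vec u)"

definition coords :: "'k vec \<Rightarrow> 'k vec" where
  "coords u = vec 5 (\<lambda>j. [L (point u) \<bullet> fst_vec u, L (point u) \<bullet> snd_vec u,
     M (point u) \<bullet> fst_vec u, M (point u) \<bullet> snd_vec u, u $ 8 * N (point u)] ! j)"

definition minor :: "'k vec \<Rightarrow> 'k" where
  "minor y = y $ 1 * y $ 2 - y $ 0 * y $ 3"

text \<open>
  The two vectors are those on which \<open>L x\<close> and \<open>M x\<close> take the values prescribed by \<open>y\<close>, found by Cramer's rule.
  Multiplication with \<open>N x * \<delta> x\<close> has cleared the denominators.
\<close>

definition backward :: "'k vec \<Rightarrow> 'k vec \<Rightarrow> 'k vec" where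
  "backward x y = pair_vec
     (N x \<cdot>\<^sub>v (y $ 2 \<cdot>\<^sub>v contract x (L x) - y $ 0 \<cdot>\<^sub>v contract x (M x)))
     (N x \<cdot>\<^sub>v (y $ 3 \<cdot>\<^sub>v contract x (L x) - y $ 1 \<cdot>\<^sub>v contract x (M x)))
     (y $ 4 * \<delta> x)"

definition forward_domain :: "'k vec set set" where
  "forward_domain = principal_open 9 (\<lambda>u. N (point u) * \<delta> (point u))"

lemma span_point_carrier [simp]: "span_point v w \<in> carrier_vec 6"
  unfolding span_point_def using P by simp

lemma contract_carrier [simp]: "contract x l \<in> carrier_vec 4"
  by (simp add: contract_def)

lemma contract_dim [simp]: "dim_vec (contract x l) = 4"
  using contract_carrier by (rule carrier_vecD)

lemma LM_carrier [simp]: "x \<in> carrier_vec 6 \<Longrightarrow> L x \<in> carrier_vec 4" "x \<in> carrier_vec 6 \<Longrightarrow> M x \<in> carrier_vec 4"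
  using L M by (auto intro: vec_form_carrier)

lemma point_carrier [simp]: "point u \<in> carrier_vec 6"
  by (simp add: point_def)

lemma coords_carrier [simp]: "coords u \<in> carrier_vec 5"
  by (simp add: coords_def)

lemma coords_index:
  "coords u $ 0 = L (point u) \<bullet> fst_vec u" "coords u $ 1 = L (point u) \<bullet> snd_vec u"
  "coords u $ 2 = M (point u) \<bullet> fst_vec u" "coords u $ 3 = M (point u) \<bullet> snd_vec u"
  "coords u $ 4 = u $ 8 * N (point u)"
  by (simp_all add: coords_def)

lemma backward_carrier [simp]: "backward x y \<in> carrier_vec 9"
  unfolding backward_def by (intro pair_vec_carrier) auto

lemma P'_P_cancel: "y \<in> carrier_vec 6 \<Longrightarrow> P' *\<^sub>v (P *\<^sub>v y) = y"
  using assoc_mult_mat_vec[OF P' P, of y] P'P by simp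

lemma P_P'_cancel: "x \<in> carrier_vec 6 \<Longrightarrow> P *\<^sub>v (P' *\<^sub>v x) = x"
  using assoc_mult_mat_vec[OF P P', of x] PP' by simp

lemma quad_form_P:
  assumes y: "y \<in> carrier_vec 6"
  shows "quad_form Q (P *\<^sub>v y) = quad_form wedge_pairing y"
proof -
  have Py: "P *\<^sub>v y \<in> carrier_vec 6" using P y by simp
  have "quad_form wedge_pairing y = y \<bullet> (transpose_mat P *\<^sub>v (Q *\<^sub>v (P *\<^sub>v y)))"
    unfolding quad_form_def isometry[symmetric]
    using assoc_mult_mat_vec[OF mult_carrier_mat[OF transpose_carrier_mat[THEN iffD2, OF P] Q] P y]
      assoc_mult_mat_vec[OF transpose_carrier_mat[THEN iffD2, OF P] Q Py] by simp
  also have "\<dots> = (transpose_mat P *\<^sub>v (Q *\<^sub>v (P *\<^sub>v y))) \<bullet> y"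
    by (rule comm_scalar_prod[OF y]) (use P Q y in simp)
  also have "\<dots> = (Q *\<^sub>v (P *\<^sub>v y)) \<bullet> (P *\<^sub>v y)"
    by (rule transpose_vec_mult_scalar[OF P y]) (use P Q y in simp)
  also have "\<dots> = quad_form Q (P *\<^sub>v y)"
    unfolding quad_form_def by (rule comm_scalar_prod[of _ 6]) (use P Q y in simp_all)
  finally show ?thesis by (rule sym)
qed

lemma quad_form_span_point: "quad_form Q (span_point v w) = 0"
  unfolding span_point_def quad_form_P[OF wedge_vec_carrier(1)]
    quad_form_wedge_pairing[OF wedge_vec_carrier(1)] pfaffian_wedge_vec by simp

lemma contract_span_point:
  assumes "v \<in> carrier_vec 4" "w \<in> carrier_vec 4" "l \<in> carrier_vec 4"
  shows "contract (span_point v w) l = (l \<bullet> w) \<cdot>\<^sub>v v - (l \<bullet> v) \<cdot>\<^sub>v w"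
  unfolding contract_def span_point_def P'_P_cancel[OF wedge_vec_carrier(1)]
  using assms by (rule alt_mat_wedge_vec)

text \<open>
  The hypothesis on \<open>x\<close> says that the tensor \<open>P' x\<close> has Pfaffian zero; dividing by \<open>2\<close> uses the characteristic.
\<close>

lemma span_point_contract:
  assumes x: "x \<in> carrier_vec 6" "quad_form Q x = 0" and "l \<in> carrier_vec 4" "m \<in> carrier_vec 4"
  shows "span_point (contract x l) (contract x m) = (l \<bullet> contract x m) \<cdot>\<^sub>v x"
proof -
  define y where "y = P' *\<^sub>v x"
  have y: "y \<in> carrier_vec 6" "P *\<^sub>v y = x"
    unfolding y_def using P' x P_P'_cancel by auto
  have "2 * (y $ 0 * y $ 5 - y $ 1 * y $ 4 + y $ 2 * y $ 3) = 0"
    using x(2) quad_form_P[OF y(1)] quad_form_wedge_pairing[OF y(1)] unfolding y(2) by simp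
  then have "y $ 0 * y $ 5 - y $ 1 * y $ 4 + y $ 2 * y $ 3 = 0"
    by (subst (asm) mult_eq_0_iff) simp
  then have "wedge_vec (alt_mat y *\<^sub>v l) (alt_mat y *\<^sub>v m) = (l \<bullet> (alt_mat y *\<^sub>v m)) \<cdot>\<^sub>v y"
    using y(1) assms(3,4) by (intro wedge_vec_alt_mat)
  then show ?thesis
    unfolding span_point_def contract_def y_def[symmetric]
    using mult_mat_vec[OF P y(1)] y(2) by simp
qed

definition forward :: "'k vec \<Rightarrow> 'k vec" where
  "forward u = tensor_vec (point u) (coords u)"

text \<open>
  Both sides are the determinant of the covectors \<open>L\<close>, \<open>M\<close> on the pair of vectors encoded by \<open>u\<close>.
\<close>

lemma delta_point: "\<delta> (point u) = minor (coords u)"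
proof -
  have "contract (point u) (L (point u))
      = (L (point u) \<bullet> snd_vec u) \<cdot>\<^sub>v fst_vec u - (L (point u) \<bullet> fst_vec u) \<cdot>\<^sub>v snd_vec u"
    by (subst (1) point_def) (simp add: contract_span_point)
  then show ?thesis
    unfolding \<delta>_def minor_def coords_index
    by (simp add: scalar_prod_minus_distrib[where n = 4] scalar_prod_smult_distrib[where n = 4])
qed

lemma backward_point_coords:
  assumes u: "u \<in> carrier_vec 9"
  shows "backward (point u) (coords u) = (N (point u) * \<delta> (point u)) \<cdot>\<^sub>v u"
proof -
  let ?v = "fst_vec u" and ?w = "snd_vec u" and ?x = "point u" and ?y = "coords u"
  have c: "contract ?x l = (l \<bullet> ?w) \<cdot>\<^sub>v ?v - (l \<bullet> ?v) \<cdot>\<^sub>v ?w" if "l \<in> carrier_vec 4" for l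
    unfolding point_def using that by (simp add: contract_span_point)
  have L: "contract ?x (L ?x) = ?y $ 1 \<cdot>\<^sub>v ?v - ?y $ 0 \<cdot>\<^sub>v ?w"
    unfolding coords_index by (rule c) simp
  have M: "contract ?x (M ?x) = ?y $ 3 \<cdot>\<^sub>v ?v - ?y $ 2 \<cdot>\<^sub>v ?w"
    unfolding coords_index by (rule c) simp
  have "backward ?x ?y = pair_vec (N ?x \<cdot>\<^sub>v (\<delta> ?x \<cdot>\<^sub>v ?v)) (N ?x \<cdot>\<^sub>v (\<delta> ?x \<cdot>\<^sub>v ?w)) (?y $ 4 * \<delta> ?x)"
    unfolding backward_def L M elimination[OF fst_snd_vec_carrier] delta_point minor_def ..
  also have "\<dots> = pair_vec ((N ?x * \<delta> ?x) \<cdot>\<^sub>v ?v) ((N ?x * \<delta> ?x) \<cdot>\<^sub>v ?w) ((N ?x * \<delta> ?x) * u $ 8)"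
    by (simp only: smult_smult_assoc coords_index mult_ac)
  also have "\<dots> = (N ?x * \<delta> ?x) \<cdot>\<^sub>v u"
    unfolding pair_vec_smult[OF fst_snd_vec_carrier] pair_vec_fst_snd[OF u] ..
  finally show ?thesis .
qed

lemma vec_form_point: "vec_form 9 6 2 point"
proof -
  have "vec_form 9 6 (1 + 1) (\<lambda>u. P *\<^sub>v wedge_vec (fst_vec u) (snd_vec u))"
    by (intro vec_form_mult_mat_vec[OF P] vec_form_wedge_vec vec_form_fst_vec vec_form_snd_vec)
  then show ?thesis unfolding point_def[abs_def] span_point_def one_add_one .
qed

lemma vec_form_contract:
  assumes "vec_form 6 4 e l"
  shows "vec_form 6 4 (1 + e) (\<lambda>x. contract x (l x))"
  unfolding contract_def
  by (rule vec_form_alt_mat[OF vec_form_mult_mat_vec[OF P' vec_form_id] assms refl])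

text \<open>
  The factors are two covector fields of degree \<open>e\<close> and one contraction, which is linear in \<open>x\<close>.
\<close>

lemma form_delta: "form 6 (2 * e + 1) \<delta>"
  unfolding \<delta>_def[abs_def]
  by (rule form_scalar_prod[OF M vec_form_contract[OF L]]) simp

lemma vec_form_coords: "vec_form 9 5 (2 * e + 1) coords"
  unfolding coords_def[abs_def]
proof (rule vec_form_vec)
  fix j :: nat assume "j < 5"
  then have j: "j = 0 \<or> j = 1 \<or> j = 2 \<or> j = 3 \<or> j = 4" by auto
  note LP = vec_form_compose[OF L vec_form_point refl] and MP = vec_form_compose[OF M vec_form_point refl]
    and NP = form_compose[OF N vec_form_point refl]
  have t: "form 9 1 (\<lambda>u. u $ 8)" by (rule form_coord) simp
  note forms = form_scalar_prod[OF LP vec_form_fst_vec refl] form_scalar_prod[OF LP vec_form_snd_vec refl]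
    form_scalar_prod[OF MP vec_form_fst_vec refl] form_scalar_prod[OF MP vec_form_snd_vec refl]
    form_mult[OF t NP add.commute]
  show "form 9 (2 * e + 1) (\<lambda>u. [L (point u) \<bullet> fst_vec u, L (point u) \<bullet> snd_vec u,
      M (point u) \<bullet> fst_vec u, M (point u) \<bullet> snd_vec u, u $ 8 * N (point u)] ! j)"
    using j forms by (elim disjE) simp_all
qed

lemma vec_form_forward: "vec_form 9 (6 * 5) (2 + (2 * e + 1)) forward"
  unfolding forward_def[abs_def] by (rule vec_form_tensor_vec[OF vec_form_point vec_form_coords refl])

lemma form_minor: "form 5 2 minor"
proof -
  have "form 5 (1 + 1) minor"
    unfolding minor_def[abs_def] by (intro form_diff form_mult[OF form_coord form_coord refl]) simp_all
  then show ?thesis unfolding one_add_one .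
qed

text \<open>
  The map is bihomogeneous of degree \<open>2 * e + 1\<close> in \<open>x\<close> and \<open>1\<close> in \<open>y\<close>.  Substituting forms for both arguments covers
  the charts of the Segre product, and constant forms give the scaling behaviour in each argument.
\<close>

lemma vec_form_backward:
  assumes X: "vec_form n 6 d X" and Y: "vec_form n 5 d' Y"
  shows "vec_form n 9 (d * (2 * e + 1) + d') (\<lambda>v. backward (X v) (Y v))"
  unfolding backward_def
proof (rule vec_form_pair_vec)
  have NX: "form n (d * e) (\<lambda>v. N (X v))" by (rule form_compose[OF N X refl])
  have c: "vec_form n 4 (d' + d * (1 + e)) (\<lambda>v. Y v $ j \<cdot>\<^sub>v contract (X v) (l (X v)))"
    if "j < 5" "vec_form 6 4 e l" for j l
    by (rule vec_form_smult[OF vec_form_coord[OF Y that(1)]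
          vec_form_compose[OF vec_form_contract[OF that(2)] X refl] refl])
  have deg: "d * (2 * e + 1) + d' = d * e + (d' + d * (1 + e))"
    by (simp add: algebra_simps)
  show "vec_form n 4 (d * (2 * e + 1) + d')
      (\<lambda>v. N (X v) \<cdot>\<^sub>v (Y v $ 2 \<cdot>\<^sub>v contract (X v) (L (X v)) - Y v $ 0 \<cdot>\<^sub>v contract (X v) (M (X v))))"
    by (rule vec_form_smult[OF NX vec_form_diff[OF c[OF _ L] c[OF _ M]] deg]) simp_all
  show "vec_form n 4 (d * (2 * e + 1) + d')
      (\<lambda>v. N (X v) \<cdot>\<^sub>v (Y v $ 3 \<cdot>\<^sub>v contract (X v) (L (X v)) - Y v $ 1 \<cdot>\<^sub>v contract (X v) (M (X v))))"
    by (rule vec_form_smult[OF NX vec_form_diff[OF c[OF _ L] c[OF _ M]] deg]) simp_all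
  show "form n (d * (2 * e + 1) + d') (\<lambda>v. Y v $ 4 * \<delta> (X v))"
    by (rule form_mult[OF vec_form_coord[OF Y] form_compose[OF form_delta X refl]]) simp_all
qed

lemma backward_smult:
  assumes x: "x \<in> carrier_vec 6" and y: "y \<in> carrier_vec 5"
  shows "backward (c \<cdot>\<^sub>v x) (d \<cdot>\<^sub>v y) = (c ^ (2 * e + 1) * d) \<cdot>\<^sub>v backward x y"
proof -
  have dy: "d \<cdot>\<^sub>v y \<in> carrier_vec 5" using y by simp
  have "backward (c \<cdot>\<^sub>v x) (d \<cdot>\<^sub>v y) = c ^ (2 * e + 1) \<cdot>\<^sub>v backward x (d \<cdot>\<^sub>v y)"
    using vec_form_homogeneous[OF vec_form_backward[OF vec_form_id vec_form_const[OF dy]] x, of c] by simp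
  also have "backward x (d \<cdot>\<^sub>v y) = d \<cdot>\<^sub>v backward x y"
    using vec_form_homogeneous[OF vec_form_backward[OF vec_form_const[OF x] vec_form_id] y, of d] by simp
  finally show ?thesis by (simp add: smult_smult_assoc)
qed

text \<open>
  The two vectors found by \<open>backward\<close> lie in the plane of \<open>x\<close>, so they span it up to the factor \<open>\<kappa>\<close>.  The covector
  fields are then evaluated at \<open>\<kappa> x\<close> instead of \<open>x\<close>, which explains the power of \<open>\<kappa>\<close> in the second formula.
\<close>

lemma point_coords_backward:
  assumes x: "x \<in> carrier_vec 6" "quad_form Q x = 0" and y: "y \<in> carrier_vec 5"
  defines "\<kappa> \<equiv> N x * N x * minor y * \<delta> x"
  shows "point (backward x y) = \<kappa> \<cdot>\<^sub>v x"
    and "coords (backward x y) = (\<kappa> ^ e * N x * \<delta> x) \<cdot>\<^sub>v y"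
proof -
  let ?l = "contract x (L x)" and ?m = "contract x (M x)" and ?u = "backward x y"
  have c: "L x \<in> carrier_vec 4" "M x \<in> carrier_vec 4" using x by simp_all
  define v where "v = y $ 2 \<cdot>\<^sub>v ?l - y $ 0 \<cdot>\<^sub>v ?m"
  define w where "w = y $ 3 \<cdot>\<^sub>v ?l - y $ 1 \<cdot>\<^sub>v ?m"
  have vw: "v \<in> carrier_vec 4" "w \<in> carrier_vec 4"
    unfolding v_def w_def by simp_all
  have "backward x y = pair_vec (N x \<cdot>\<^sub>v v) (N x \<cdot>\<^sub>v w) (y $ 4 * \<delta> x)"
    unfolding backward_def v_def w_def ..
  then have u: "fst_vec ?u = N x \<cdot>\<^sub>v v" "snd_vec ?u = N x \<cdot>\<^sub>v w" "?u $ 8 = y $ 4 * \<delta> x"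
    using vw by (simp_all add: pair_vec_components)
  have Lm: "L x \<bullet> ?m = - \<delta> x"
    unfolding \<delta>_def contract_def using c by (rule scalar_prod_alt_mat_swap)
  have Ll: "L x \<bullet> ?l = 0" and Mm: "M x \<bullet> ?m = 0"
    unfolding contract_def using c by (simp_all only: scalar_prod_alt_mat_self)
  have "point ?u = P *\<^sub>v ((N x * N x * (y $ 0 * y $ 3 - y $ 1 * y $ 2)) \<cdot>\<^sub>v wedge_vec ?l ?m)"
    unfolding point_def span_point_def u wedge_vec_smult[OF vw]
    unfolding v_def w_def wedge_vec_combination[OF contract_carrier contract_carrier] smult_smult_assoc ..
  also have "\<dots> = (N x * N x * (y $ 0 * y $ 3 - y $ 1 * y $ 2)) \<cdot>\<^sub>v span_point ?l ?m"
    unfolding span_point_def by (rule mult_mat_vec[OF P wedge_vec_carrier(1)])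
  also have "\<dots> = (N x * N x * (y $ 0 * y $ 3 - y $ 1 * y $ 2) * - \<delta> x) \<cdot>\<^sub>v x"
    unfolding span_point_contract[OF x c] Lm smult_smult_assoc ..
  also have "N x * N x * (y $ 0 * y $ 3 - y $ 1 * y $ 2) * - \<delta> x = \<kappa>"
    unfolding \<kappa>_def minor_def by (simp add: algebra_simps)
  finally show p: "point ?u = \<kappa> \<cdot>\<^sub>v x" .
  have forms: "L (point ?u) = \<kappa> ^ e \<cdot>\<^sub>v L x" "M (point ?u) = \<kappa> ^ e \<cdot>\<^sub>v M x" "N (point ?u) = \<kappa> ^ e * N x"
    unfolding p using vec_form_homogeneous[OF L x(1)] vec_form_homogeneous[OF M x(1)]
      form_homogeneous[OF N x(1)] by simp_all
  have prod: "(s \<cdot>\<^sub>v l) \<bullet> (t \<cdot>\<^sub>v (b \<cdot>\<^sub>v ?l - a \<cdot>\<^sub>v ?m)) = s * (t * (b * (l \<bullet> ?l) - a * (l \<bullet> ?m)))"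
    if "l \<in> carrier_vec 4" for l s t a b
    using that by (simp add: scalar_prod_minus_distrib[where n = 4] algebra_simps)
  show "coords ?u = (\<kappa> ^ e * N x * \<delta> x) \<cdot>\<^sub>v y"
  proof (rule eq_vecI)
    fix j assume "j < dim_vec ((\<kappa> ^ e * N x * \<delta> x) \<cdot>\<^sub>v y)"
    then have j: "j < 5" using y by simp
    then have cases: "j = 0 \<or> j = 1 \<or> j = 2 \<or> j = 3 \<or> j = 4" by auto
    have d: "M x \<bullet> ?l = \<delta> x" unfolding \<delta>_def ..
    have "coords ?u $ j = \<kappa> ^ e * N x * \<delta> x * y $ j"
      using cases
      by (elim disjE) (hypsubst, unfold coords_index forms u v_def w_def prod[OF c(1)] prod[OF c(2)]
          Ll Lm Mm d, simp add: mult_ac)+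
    then show "coords ?u $ j = ((\<kappa> ^ e * N x * \<delta> x) \<cdot>\<^sub>v y) $ j" using j y by simp
  qed (use y in simp)
qed

lemma forward_backward:
  assumes "x \<in> carrier_vec 6" "quad_form Q x = 0" "y \<in> carrier_vec 5"
    and "N x \<noteq> 0" "\<delta> x \<noteq> 0" "minor y \<noteq> 0"
  shows "\<exists>c. c \<noteq> 0 \<and> forward (backward x y) = c \<cdot>\<^sub>v tensor_vec x y"
  unfolding forward_def point_coords_backward[OF assms(1-3)] tensor_vec_smult[OF assms(1,3)]
  using assms(4-6) by - (rule exI, rule conjI[rotated], rule refl, simp)

lemma form_dom: "form 9 (2 * e + 2 * (2 * e + 1)) (\<lambda>u. N (point u) * \<delta> (point u))"
  by (rule form_mult[OF form_compose[OF N vec_form_point refl] form_compose[OF form_delta vec_form_point refl] refl])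

lemma proj_point_in_dom_iff:
  "proj_point u \<in> forward_domain \<longleftrightarrow> u \<in> carrier_vec 9 \<and> N (point u) \<noteq> 0 \<and> \<delta> (point u) \<noteq> 0"
proof
  assume u: "proj_point u \<in> forward_domain"
  have "proj_point u \<in> proj_space 9" "N (point u) * \<delta> (point u) \<noteq> 0"
    using u mem_proj_point[of u] unfolding forward_domain_def principal_open_def by blast+
  then show "u \<in> carrier_vec 9 \<and> N (point u) \<noteq> 0 \<and> \<delta> (point u) \<noteq> 0"
    using proj_space_memD(1)[OF _ mem_proj_point] by simp
next
  assume u: "u \<in> carrier_vec 9 \<and> N (point u) \<noteq> 0 \<and> \<delta> (point u) \<noteq> 0"
  then have "u \<noteq> 0\<^sub>v 9" using form_zero_vec[OF form_dom] by auto
  with u have p: "proj_point u \<in> proj_space 9" by simp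
  then show "proj_point u \<in> forward_domain"
    using form_nonzero_on_point_iff[OF form_dom p mem_proj_point] u
    unfolding forward_domain_def principal_open_def by simp
qed

lemma backward_in_dom:
  assumes "x \<in> carrier_vec 6" "quad_form Q x = 0" "y \<in> carrier_vec 5"
    and "N x \<noteq> 0" "\<delta> x \<noteq> 0" "minor y \<noteq> 0"
  shows "proj_point (backward x y) \<in> forward_domain"
  unfolding proj_point_in_dom_iff point_coords_backward[OF assms(1-3)]
    form_homogeneous[OF N assms(1)] form_homogeneous[OF form_delta assms(1)]
  using assms(4-6) by simp

lemma point_coords_nonzero:
  assumes "proj_point u \<in> forward_domain"
  shows "point u \<noteq> 0\<^sub>v 6" "coords u \<noteq> 0\<^sub>v 5"
proof -
  have d: "\<delta> (point u) \<noteq> 0" using assms unfolding proj_point_in_dom_iff by blast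
  then show "point u \<noteq> 0\<^sub>v 6" using form_zero_vec[OF form_delta] by auto
  show "coords u \<noteq> 0\<^sub>v 5" using d form_zero_vec[OF form_minor] unfolding delta_point by auto
qed

lemma proj_map_forward:
  assumes "proj_point u \<in> forward_domain"
  shows "proj_map forward (proj_point u) = segre (proj_point (point u)) (proj_point (coords u))"
proof -
  have "u \<in> carrier_vec 9" using assms unfolding proj_point_in_dom_iff by blast
  then show ?thesis
    unfolding segre_proj_point[OF point_carrier coords_carrier] forward_def[symmetric]
    by (rule proj_map_proj_point[OF vec_form_forward])
qed

lemma point_in_quadric:
  assumes "proj_point u \<in> forward_domain"
  shows "proj_point (point u) \<in> quadric 6 Q"
  using proj_point_in_quadric_iff[OF Q point_carrier point_coords_nonzero(1)[OF assms]]
  by (simp add: point_def quad_form_span_point)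

text \<open>
  Column \<open>snd a\<close> and row \<open>fst a\<close> of a point \<open>x \<otimes> y\<close> are multiples of \<open>x\<close> and \<open>y\<close>.  The chart is nonzero where
  these multiples are nonzero and lie in the locus where \<open>backward\<close> inverts \<open>forward\<close>.
\<close>

definition chart :: "nat \<times> nat \<Rightarrow> 'k vec \<Rightarrow> 'k" where
  "chart a z = N (tensor_col 6 5 z (snd a)) * \<delta> (tensor_col 6 5 z (snd a)) * minor (tensor_row 5 z (fst a))"

lemma chart_tensor_vec:
  assumes x: "x \<in> carrier_vec 6" and y: "y \<in> carrier_vec 5" and a: "a \<in> {..<6} \<times> {..<5}"
  shows "chart a (tensor_vec x y)
    = N (y $ snd a \<cdot>\<^sub>v x) * \<delta> (y $ snd a \<cdot>\<^sub>v x) * minor (x $ fst a \<cdot>\<^sub>v y)"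
proof -
  have "fst a < 6" "snd a < 5" using a by auto
  then show ?thesis
    unfolding chart_def using tensor_col_tensor_vec[OF x y] tensor_row_tensor_vec[OF x y] by simp
qed

lemma chart_nonzeroD:
  assumes "x \<in> carrier_vec 6" "y \<in> carrier_vec 5" "a \<in> {..<6} \<times> {..<5}" "chart a (tensor_vec x y) \<noteq> 0"
  shows "y $ snd a \<noteq> 0" "x $ fst a \<noteq> 0" "N (y $ snd a \<cdot>\<^sub>v x) \<noteq> 0" "\<delta> (y $ snd a \<cdot>\<^sub>v x) \<noteq> 0"
    "minor (x $ fst a \<cdot>\<^sub>v y) \<noteq> 0"
proof -
  show "N (y $ snd a \<cdot>\<^sub>v x) \<noteq> 0" and d: "\<delta> (y $ snd a \<cdot>\<^sub>v x) \<noteq> 0"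
    and m: "minor (x $ fst a \<cdot>\<^sub>v y) \<noteq> 0"
    using assms(4) unfolding chart_tensor_vec[OF assms(1-3)] by auto
  show "y $ snd a \<noteq> 0"
    using d unfolding form_homogeneous[OF form_delta assms(1)] by auto
  show "x $ fst a \<noteq> 0"
    using m unfolding form_homogeneous[OF form_minor assms(2)] by auto
qed

text \<open>
  Over a point \<open>x\<close> of the quadric with \<open>N x * \<delta> x \<noteq> 0\<close> the covectors \<open>L x\<close>, \<open>M x\<close> are coordinates on the plane of
  \<open>x\<close>, so a pair of vectors spanning this plane is the same as an invertible matrix of values.  Hence the
  image consists of the points over this locus where the first four coordinates of the
  second factor form an invertible matrix.  The point \<open>x0\<close> shows that the locus is nonempty.
\<close>

lemma birational_map_forward:
  assumes x0: "x0 \<in> carrier_vec 6" "quad_form Q x0 = 0" "N x0 \<noteq> 0" "\<delta> x0 \<noteq> 0"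
  shows "birational_map 9 (proj_space 9) (6 * 5) (prod_variety (quadric 6 Q) (proj_space 5))
    forward_domain (proj_map forward)"
proof (rule birational_map_of_forms[where I = "{..<6} \<times> {..<5}" and D = chart
      and e = "\<lambda>_. e + (2 * e + 1) + 2" and k = "\<lambda>_. 1 * (2 * e + 1) + 1"
      and H = "\<lambda>a z. backward (tensor_col 6 5 z (snd a)) (tensor_row 5 z (fst a))"])
  let ?H = "\<lambda>a z. backward (tensor_col 6 5 z (snd a)) (tensor_row 5 z (fst a))"
  have H: "?H a (tensor_vec x y) = backward (y $ snd a \<cdot>\<^sub>v x) (x $ fst a \<cdot>\<^sub>v y)"
    if "x \<in> carrier_vec 6" "y \<in> carrier_vec 5" "a \<in> {..<6} \<times> {..<5}" for x y a
  proof -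
    have "fst a < 6" "snd a < 5" using that(3) by auto
    then show ?thesis
      using tensor_col_tensor_vec[OF that(1,2)] tensor_row_tensor_vec[OF that(1,2)] by simp
  qed
  show "prod_variety (quadric 6 Q) (proj_space 5) \<subseteq> proj_space (6 * 5)"
    by (rule prod_variety_subset[OF quadric_subset subset_refl])
  have "forward_domain = forward_domain \<inter> proj_space 9" unfolding forward_domain_def principal_open_def by blast
  then show "openin (zariski_on 9 (proj_space 9)) forward_domain"
    using openin_principal_open_Int[OF form_dom] unfolding forward_domain_def by metis
  \<comment> \<open>With \<open>y0 = (0, 1, 1, 0, 0)\<close> the minor is \<open>1\<close>.\<close>
  define y0 :: "'k vec" where "y0 = vec 5 (\<lambda>i. if i = 1 \<or> i = 2 then 1 else 0)"
  have "y0 \<in> carrier_vec 5" "minor y0 \<noteq> 0" unfolding y0_def minor_def by simp_all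
  then have "proj_point (backward x0 y0) \<in> forward_domain" using x0 by (intro backward_in_dom)
  then show "forward_domain \<noteq> {}" by blast
  show "vec_form 9 (6 * 5) (2 + (2 * e + 1)) forward" by (rule vec_form_forward)
  fix a :: "nat \<times> nat" assume a: "a \<in> {..<6} \<times> {..<5}"
  then have ij: "fst a < 6" "snd a < 5" by auto
  note col = vec_form_tensor_col[OF ij(2), of 6] and row = vec_form_tensor_row[OF ij(1), of 5]
  have "form (6 * 5) (1 * e + 1 * (2 * e + 1) + 1 * 2) (chart a)"
    unfolding chart_def[abs_def]
    by (rule form_mult[OF form_mult[OF form_compose[OF N col refl] form_compose[OF form_delta col refl] refl]
          form_compose[OF form_minor row refl] refl])
  then show "form (6 * 5) (e + (2 * e + 1) + 2) (chart a)" by simp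
  show "vec_form (6 * 5) 9 (1 * (2 * e + 1) + 1) (?H a)"
    by (rule vec_form_backward[OF col row])
  show "\<exists>c. c \<noteq> 0 \<and> ?H a (forward u) = c \<cdot>\<^sub>v u"
    if u: "proj_point u \<in> forward_domain" and ne: "chart a (forward u) \<noteq> 0" for u
  proof -
    have u': "u \<in> carrier_vec 9" "N (point u) \<noteq> 0" "\<delta> (point u) \<noteq> 0"
      using u unfolding proj_point_in_dom_iff by auto
    note nz = chart_nonzeroD[OF point_carrier coords_carrier a ne[unfolded forward_def]]
    show ?thesis
      unfolding forward_def H[OF point_carrier coords_carrier a] backward_smult[OF point_carrier coords_carrier]
        backward_point_coords[OF u'(1)] smult_smult_assoc
      using u'(2,3) nz(1,2) by - (rule exI, rule conjI[rotated], rule refl, simp)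
  qed
  fix z assume z: "proj_point z \<in> prod_variety (quadric 6 Q) (proj_space 5)" and ne: "chart a z \<noteq> 0"
  obtain x y where zxy: "z = tensor_vec x y" and x: "x \<in> carrier_vec 6" "quad_form Q x = 0"
    and y: "y \<in> carrier_vec 5"
    using z by (rule prod_variety_quadricE[OF Q])
  note nz = chart_nonzeroD[OF x(1) y a ne[unfolded zxy]]
  have cx: "y $ snd a \<cdot>\<^sub>v x \<in> carrier_vec 6" "quad_form Q (y $ snd a \<cdot>\<^sub>v x) = 0"
    using x quad_form_smult[OF Q x(1)] by simp_all
  have dy: "x $ fst a \<cdot>\<^sub>v y \<in> carrier_vec 5" using y by simp
  show "proj_point (?H a z) \<in> forward_domain"
    unfolding zxy H[OF x(1) y a] by (rule backward_in_dom[OF cx dy nz(3-5)])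
  obtain c where c: "c \<noteq> 0"
    "forward (backward (y $ snd a \<cdot>\<^sub>v x) (x $ fst a \<cdot>\<^sub>v y)) = c \<cdot>\<^sub>v tensor_vec (y $ snd a \<cdot>\<^sub>v x) (x $ fst a \<cdot>\<^sub>v y)"
    using forward_backward[OF cx dy nz(3-5)] by blast
  show "\<exists>c. c \<noteq> 0 \<and> forward (?H a z) = c \<cdot>\<^sub>v z"
    unfolding zxy H[OF x(1) y a] c(2) tensor_vec_smult[OF x(1) y] smult_smult_assoc
    using c(1) nz(1,2) by - (rule exI, rule conjI[rotated], rule refl, simp)
next
  fix u assume u: "proj_point u \<in> forward_domain"
  note ne = point_coords_nonzero[OF u]
  have "segre (proj_point (point u)) (proj_point (coords u)) \<in> prod_variety (quadric 6 Q) (proj_space 5)"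
    unfolding prod_variety_def
    using point_in_quadric[OF u] proj_point_in_proj_space[OF coords_carrier ne(2)] by blast
  then show "forward u \<noteq> 0\<^sub>v (6 * 5) \<and> proj_point (forward u) \<in> prod_variety (quadric 6 Q) (proj_space 5)"
    unfolding forward_def segre_proj_point[OF point_carrier coords_carrier]
    using tensor_vec_nonzero[OF point_carrier ne(1) coords_carrier ne(2)] by simp
  obtain i where i: "i < 6" "point u $ i \<noteq> 0" using point_carrier ne(1) by (rule nonzero_vec_index)
  obtain j where j: "j < 5" "coords u $ j \<noteq> 0" using coords_carrier ne(2) by (rule nonzero_vec_index)
  have a: "(i, j) \<in> {..<6} \<times> {..<5}" using i(1) j(1) by simp
  have "N (point u) \<noteq> 0" "\<delta> (point u) \<noteq> 0" "minor (coords u) \<noteq> 0"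
    using u unfolding proj_point_in_dom_iff delta_point[symmetric] by auto
  then have "chart (i, j) (forward u) \<noteq> 0"
    unfolding forward_def chart_tensor_vec[OF point_carrier coords_carrier a]
      form_homogeneous[OF N point_carrier] form_homogeneous[OF form_delta point_carrier]
      form_homogeneous[OF form_minor coords_carrier]
    using i(2) j(2) by simp
  with a show "\<exists>a\<in>{..<6} \<times> {..<5}. chart a (forward u) \<noteq> 0" by blast
qed simp

end

section \<open>Averaging over a finite matrix group\<close>

lemma proj_action_proj_point:
  fixes A :: "'k::field mat"
  assumes "A \<in> carrier_mat m n" "v \<in> carrier_vec n"
  shows "proj_action A (proj_point v) = proj_point (A *\<^sub>v v)"
  unfolding proj_action_def proj_point_def image_Collect
  using mult_mat_vec[OF assms] by (intro Collect_cong) metis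

text \<open>
  For \<open>y \<noteq> 0\<close> the forms \<open>y\<^sub>r v\<^sub>i - y\<^sub>i v\<^sub>r\<close> with \<open>y\<^sub>r \<noteq> 0\<close> cut out the line of \<open>y\<close>.
\<close>

lemma separating_linear_form:
  fixes x y :: "'k::field vec"
  assumes x: "x \<in> carrier_vec n" "x \<noteq> 0\<^sub>v n" and y: "y \<in> carrier_vec n"
    and ne: "proj_point x \<noteq> proj_point y"
  shows "\<exists>f. form n 1 f \<and> f x \<noteq> 0 \<and> f y = 0"
proof (cases "y = 0\<^sub>v n")
  case True
  obtain i where i: "i < n" "x $ i \<noteq> 0" using x by (rule nonzero_vec_index)
  have "y $ i = 0" unfolding True using i(1) by simp
  then show ?thesis using form_coord[OF i(1)] i(2) by blast
next
  case False
  obtain r where r: "r < n" "y $ r \<noteq> 0" using y False by (rule nonzero_vec_index)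
  have "\<exists>i<n. x $ i * y $ r - x $ r * y $ i \<noteq> 0"
  proof (rule ccontr)
    assume "\<not> (\<exists>i<n. x $ i * y $ r - x $ r * y $ i \<noteq> 0)"
    then have eq: "x $ i = x $ r / y $ r * y $ i" if "i < n" for i
      using that r(2) by (simp add: field_simps)
    have x': "x = (x $ r / y $ r) \<cdot>\<^sub>v y"
      using x(1) y eq by (intro eq_vecI) auto
    have "x $ r / y $ r \<noteq> 0"
    proof
      assume "x $ r / y $ r = 0"
      then have "x = 0\<^sub>v n" using x(1) eq by (intro eq_vecI) auto
      then show False using x(2) by contradiction
    qed
    then have "proj_point ((x $ r / y $ r) \<cdot>\<^sub>v y) = proj_point y" by (rule proj_point_smult)
    then show False using ne unfolding x'[symmetric] by contradiction
  qed
  then obtain i where i: "i < n" "x $ i * y $ r - x $ r * y $ i \<noteq> 0" by blast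
  have "form n 1 (\<lambda>v. y $ r * v $ i - y $ i * v $ r)"
    by (intro form_diff form_scale form_coord i(1) r(1))
  then show ?thesis
    using i(2) by (intro exI[of _ "\<lambda>v. y $ r * v $ i - y $ i * v $ r"]) (simp add: mult.commute)
qed

text \<open>
  The product over \<open>g \<noteq> 1\<close> of linear forms that vanish at \<open>g x\<close> but not at \<open>x\<close>.
\<close>

lemma separating_form:
  fixes x :: "'k::field vec"
  assumes "finite G" "G \<subseteq> carrier_mat n n" and x: "x \<in> carrier_vec n" "x \<noteq> 0\<^sub>v n"
    and free: "\<And>g. g \<in> G \<Longrightarrow> proj_action g (proj_point x) = proj_point x \<Longrightarrow> g = 1\<^sub>m n"
  shows "\<exists>d f. form n d f \<and> f x \<noteq> 0 \<and> (\<forall>g\<in>G - {1\<^sub>m n}. f (g *\<^sub>v x) = 0)"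
proof -
  have "\<exists>f. form n 1 f \<and> f x \<noteq> 0 \<and> f (g *\<^sub>v x) = 0" if g: "g \<in> G - {1\<^sub>m n}" for g
  proof (rule separating_linear_form[OF x])
    have gc: "g \<in> carrier_mat n n" using g assms(2) by blast
    then show "g *\<^sub>v x \<in> carrier_vec n" using x(1) by simp
    show "proj_point x \<noteq> proj_point (g *\<^sub>v x)"
      using free[of g] g proj_action_proj_point[OF gc x(1)] by auto
  qed
  then obtain f where f: "\<And>g. g \<in> G - {1\<^sub>m n} \<Longrightarrow> form n 1 (f g)"
    "\<And>g. g \<in> G - {1\<^sub>m n} \<Longrightarrow> f g x \<noteq> 0" "\<And>g. g \<in> G - {1\<^sub>m n} \<Longrightarrow> f g (g *\<^sub>v x) = 0"
    by metis
  have fin: "finite (G - {1\<^sub>m n})" using assms(1) by simp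
  have "form n (\<Sum>g\<in>G - {1\<^sub>m n}. 1) (\<lambda>v. \<Prod>g\<in>G - {1\<^sub>m n}. f g v)"
    by (rule form_prod[OF fin f(1)])
  moreover have "(\<Prod>g\<in>G - {1\<^sub>m n}. f g x) \<noteq> 0" using fin f(2) by simp
  moreover have "\<forall>g\<in>G - {1\<^sub>m n}. (\<Prod>h\<in>G - {1\<^sub>m n}. f h (g *\<^sub>v x)) = 0"
    using fin f(3) by (intro ballI prod_zero) auto
  ultimately show ?thesis by blast
qed

definition avg :: "'k::field mat set \<Rightarrow> ('k vec \<Rightarrow> 'k) \<Rightarrow> 'k vec \<Rightarrow> 'k" where
  "avg G h x = (\<Sum>g\<in>G. h (g *\<^sub>v x))"

text \<open>
  Pairing with \<open>v\<close> gives \<open>\<Sum>\<^sub>g h (g x) (A g v)\<^sub>i\<close>: the \<open>i\<close>-th coordinate function is moved around by \<open>G\<close>,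
  with weights that depend on \<open>x\<close>.
\<close>

definition avg_covector ::
  "'k::field mat set \<Rightarrow> ('k mat \<Rightarrow> 'k mat) \<Rightarrow> nat \<Rightarrow> ('k vec \<Rightarrow> 'k) \<Rightarrow> nat \<Rightarrow> 'k vec \<Rightarrow> 'k vec" where
  "avg_covector G A r h i x = vec r (\<lambda>j. \<Sum>g\<in>G. h (g *\<^sub>v x) * A g $$ (i, j))"

lemma form_translate:
  assumes "g \<in> carrier_mat n n" "form n d h"
  shows "form n d (\<lambda>x. h (g *\<^sub>v x))"
  by (rule form_compose[OF assms(2) vec_form_mult_mat_vec[OF assms(1) vec_form_id]]) simp

lemma form_avg:
  assumes "finite G" "G \<subseteq> carrier_mat n n" "form n d h"
  shows "form n d (avg G h)"
  unfolding avg_def[abs_def] using assms by (intro form_sum form_translate) auto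

lemma vec_form_avg_covector:
  assumes "finite G" "G \<subseteq> carrier_mat n n" "form n d h"
  shows "vec_form n r d (avg_covector G A r h i)"
  unfolding avg_covector_def[abs_def]
proof (rule vec_form_vec)
  have "form n d (\<lambda>x. A g $$ (i, j) * h (g *\<^sub>v x))" if "g \<in> G" for g j
    using assms(2,3) that by (intro form_scale form_translate) auto
  then show "form n d (\<lambda>x. \<Sum>g\<in>G. h (g *\<^sub>v x) * A g $$ (i, j))" for j
    using assms(1) by (intro form_sum) (simp_all add: mult.commute)
qed

lemma avg_covector_scalar_prod:
  assumes "\<And>g. g \<in> G \<Longrightarrow> A g \<in> carrier_mat r r" "i < r" "v \<in> carrier_vec r"
  shows "avg_covector G A r h i x \<bullet> v = (\<Sum>g\<in>G. h (g *\<^sub>v x) * (A g *\<^sub>v v) $ i)"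
proof -
  have "avg_covector G A r h i x \<bullet> v = (\<Sum>j<r. \<Sum>g\<in>G. h (g *\<^sub>v x) * (A g $$ (i, j) * v $ j))"
    using assms(3) by (simp add: avg_covector_def scalar_prod_def atLeast0LessThan sum_distrib_right mult.assoc)
  also have "\<dots> = (\<Sum>g\<in>G. h (g *\<^sub>v x) * (\<Sum>j<r. A g $$ (i, j) * v $ j))"
    by (subst sum.swap) (simp only: sum_distrib_left)
  also have "\<dots> = (\<Sum>g\<in>G. h (g *\<^sub>v x) * (A g *\<^sub>v v) $ i)"
  proof (rule sum.cong[OF refl])
    fix g assume "g \<in> G"
    then have "A g \<in> carrier_mat r r" by (rule assms(1))
    then show "h (g *\<^sub>v x) * (\<Sum>j<r. A g $$ (i, j) * v $ j) = h (g *\<^sub>v x) * (A g *\<^sub>v v) $ i"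
      using assms(2,3) by (simp add: scalar_prod_def atLeast0LessThan)
  qed
  finally show ?thesis .
qed

text \<open>
  Right translation by \<open>k\<close> is injective because \<open>k\<close> is invertible as a matrix, hence bijective on the finite set \<open>G\<close>.
\<close>

lemma sum_translate:
  fixes G :: "'k::field mat set"
  assumes "finite G" "G \<subseteq> carrier_mat n n" "\<And>g g'. g \<in> G \<Longrightarrow> g' \<in> G \<Longrightarrow> g * g' \<in> G"
    and k: "k \<in> G" "det k = 1"
  shows "(\<Sum>g\<in>G. f (g * k)) = (\<Sum>g\<in>G. f g)"
proof -
  have kc: "k \<in> carrier_mat n n" using k(1) assms(2) by blast
  have k': "adj_mat k \<in> carrier_mat n n" "k * adj_mat k = 1\<^sub>m n"
    using adj_mat[OF kc] k(2) by auto
  have cancel: "(g * k) * adj_mat k = g" if "g \<in> G" for g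
  proof -
    have "g \<in> carrier_mat n n" using that assms(2) by blast
    then show ?thesis using assoc_mult_mat[OF _ kc k'(1)] k'(2) by simp
  qed
  have inj: "inj_on (\<lambda>g. g * k) G"
  proof (rule inj_onI)
    fix a b assume a: "a \<in> G" and b: "b \<in> G" and eq: "a * k = b * k"
    show "a = b" using cancel[OF a] unfolding eq cancel[OF b] by (rule sym)
  qed
  moreover have "(\<lambda>g. g * k) ` G \<subseteq> G" using assms(3) k(1) by blast
  ultimately have "bij_betw (\<lambda>g. g * k) G G"
    unfolding bij_betw_def using endo_inj_surj[OF assms(1)] by blast
  then show ?thesis by (rule sum.reindex_bij_betw)
qed

lemma avg_invariant:
  assumes "finite G" "G \<subseteq> carrier_mat n n" "\<And>g g'. g \<in> G \<Longrightarrow> g' \<in> G \<Longrightarrow> g * g' \<in> G"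
    and k: "k \<in> G" "det k = 1" and x: "x \<in> carrier_vec n"
  shows "avg G h (k *\<^sub>v x) = avg G h x"
proof -
  have "avg G h (k *\<^sub>v x) = (\<Sum>g\<in>G. h ((g * k) *\<^sub>v x))"
    unfolding avg_def
  proof (rule sum.cong[OF refl])
    fix g assume "g \<in> G"
    then have c: "g \<in> carrier_mat n n" "k \<in> carrier_mat n n" using k(1) assms(2) by auto
    show "h (g *\<^sub>v (k *\<^sub>v x)) = h ((g * k) *\<^sub>v x)"
      unfolding assoc_mult_mat_vec[OF c x] ..
  qed
  also have "\<dots> = avg G h x"
    unfolding avg_def by (rule sum_translate[OF assms(1-3) k])
  finally show ?thesis .
qed

text \<open>
  After substituting \<open>k x\<close> and \<open>A k v\<close> the summand at \<open>g\<close> is the original summand at \<open>g k\<close>.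
\<close>

lemma avg_covector_equivariant:
  assumes "finite G" "G \<subseteq> carrier_mat n n" and closed: "\<And>g g'. g \<in> G \<Longrightarrow> g' \<in> G \<Longrightarrow> g * g' \<in> G"
    and A: "\<And>g. g \<in> G \<Longrightarrow> A g \<in> carrier_mat r r"
      "\<And>g g'. g \<in> G \<Longrightarrow> g' \<in> G \<Longrightarrow> A (g * g') = A g * A g'"
    and k: "k \<in> G" "det k = 1" and x: "x \<in> carrier_vec n" and i: "i < r" and v: "v \<in> carrier_vec r"
  shows "avg_covector G A r h i (k *\<^sub>v x) \<bullet> (A k *\<^sub>v v) = avg_covector G A r h i x \<bullet> v"
proof -
  have Av: "A k *\<^sub>v v \<in> carrier_vec r" using A(1)[OF k(1)] v by simp
  have "avg_covector G A r h i (k *\<^sub>v x) \<bullet> (A k *\<^sub>v v)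
      = (\<Sum>g\<in>G. h (g *\<^sub>v (k *\<^sub>v x)) * (A g *\<^sub>v (A k *\<^sub>v v)) $ i)"
    using A(1) i Av by (rule avg_covector_scalar_prod)
  also have "\<dots> = (\<Sum>g\<in>G. h ((g * k) *\<^sub>v x) * (A (g * k) *\<^sub>v v) $ i)"
  proof (rule sum.cong[OF refl])
    fix g assume g: "g \<in> G"
    have c: "g \<in> carrier_mat n n" "k \<in> carrier_mat n n" using g k(1) assms(2) by auto
    show "h (g *\<^sub>v (k *\<^sub>v x)) * (A g *\<^sub>v (A k *\<^sub>v v)) $ i = h ((g * k) *\<^sub>v x) * (A (g * k) *\<^sub>v v) $ i"
      unfolding A(2)[OF g k(1)] assoc_mult_mat_vec[OF c x] assoc_mult_mat_vec[OF A(1)[OF g] A(1)[OF k(1)] v] ..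
  qed
  also have "\<dots> = (\<Sum>g\<in>G. h (g *\<^sub>v x) * (A g *\<^sub>v v) $ i)"
    by (rule sum_translate[OF assms(1,2) closed k])
  also have "\<dots> = avg_covector G A r h i x \<bullet> v"
    using A(1) i v by (rule avg_covector_scalar_prod[symmetric])
  finally show ?thesis .
qed

text \<open>
  The weights \<open>h (g x)\<close> vanish unless \<open>g = 1\<close>.
\<close>

lemma avg_at_separated_point:
  assumes "finite G" "1\<^sub>m n \<in> G" "x \<in> carrier_vec n" and zero: "\<forall>g\<in>G - {1\<^sub>m n}. h (g *\<^sub>v x) = 0"
  shows "avg G h x = h x"
    and "A (1\<^sub>m n) = 1\<^sub>m r \<Longrightarrow> i < r \<Longrightarrow> avg_covector G A r h i x = h x \<cdot>\<^sub>v unit_vec r i"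
proof -
  have s: "(\<Sum>g\<in>G. h (g *\<^sub>v x) * c g) = h x * c (1\<^sub>m n)" for c :: "'a mat \<Rightarrow> 'a"
  proof -
    have "(\<Sum>g\<in>G. h (g *\<^sub>v x) * c g) = (\<Sum>g\<in>{1\<^sub>m n}. h (g *\<^sub>v x) * c g)"
      using assms(1,2) zero by (intro sum.mono_neutral_right) auto
    then show ?thesis using assms(3) by simp
  qed
  show "avg G h x = h x" unfolding avg_def using s[of "\<lambda>_. 1"] by simp
  show "avg_covector G A r h i x = h x \<cdot>\<^sub>v unit_vec r i" if "A (1\<^sub>m n) = 1\<^sub>m r" "i < r"
    unfolding avg_covector_def s that(1) using that(2) by (intro eq_vecI) auto
qed

section \<open>The linear representation\<close>

text \<open>
  The representation \<open>V \<oplus> V \<oplus> k\<close> in the coordinates of \<open>pair_vec\<close>.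
\<close>

definition double_rep :: "'k::field mat \<Rightarrow> 'k mat" where
  "double_rep A = four_block_mat (four_block_mat A (0\<^sub>m 4 4) (0\<^sub>m 4 4) A) (0\<^sub>m 8 1) (0\<^sub>m 1 8) (1\<^sub>m 1)"

lemma double_rep_carrier:
  assumes "A \<in> carrier_mat 4 4"
  shows "double_rep A \<in> carrier_mat 9 9"
  using assms unfolding double_rep_def carrier_mat_def by simp

lemma double_rep_mult:
  assumes A: "A \<in> carrier_mat 4 4" and B: "B \<in> carrier_mat 4 4"
  shows "double_rep (A * B) = double_rep A * double_rep B"
proof -
  have z: "0\<^sub>m 4 4 \<in> carrier_mat 4 4" by simp
  have 4: "four_block_mat A (0\<^sub>m 4 4) (0\<^sub>m 4 4) A * four_block_mat B (0\<^sub>m 4 4) (0\<^sub>m 4 4) B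
      = four_block_mat (A * B) (0\<^sub>m 4 4) (0\<^sub>m 4 4) (A * B)"
    using A B by (subst mult_four_block_mat[OF A z z A B z z B]) simp
  have c: "four_block_mat C (0\<^sub>m 4 4) (0\<^sub>m 4 4) C \<in> carrier_mat 8 8" if "C \<in> carrier_mat 4 4" for C :: "'a mat"
    using that unfolding carrier_mat_def by simp
  show ?thesis
    unfolding double_rep_def 4[symmetric]
    by (subst mult_four_block_mat[OF c[OF A] zero_carrier_mat zero_carrier_mat one_carrier_mat
          c[OF B] zero_carrier_mat zero_carrier_mat one_carrier_mat])
      (use mult_carrier_mat[OF c[OF A] c[OF B]] in \<open>simp add: right_mult_zero_mat[OF c[OF A]] left_mult_zero_mat[OF c[OF B]]\<close>)
qed

lemma double_rep_one: "double_rep (1\<^sub>m 4) = 1\<^sub>m 9"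
  unfolding double_rep_def by (intro eq_matI) auto

lemma double_rep_pair_vec:
  assumes A: "A \<in> carrier_mat 4 4" and v: "v \<in> carrier_vec 4" and w: "w \<in> carrier_vec 4"
  shows "double_rep A *\<^sub>v pair_vec v w t = pair_vec (A *\<^sub>v v) (A *\<^sub>v w) t"
proof -
  have c: "four_block_mat A (0\<^sub>m 4 4) (0\<^sub>m 4 4) A \<in> carrier_mat 8 8"
    using A unfolding carrier_mat_def by simp
  have vw: "v @\<^sub>v w \<in> carrier_vec 8"
    using v w by (intro carrier_vecI) simp
  show ?thesis
    unfolding double_rep_def pair_vec_def
    by (subst mult_mat_vec_split[OF c one_carrier_mat vw]) (simp_all add: mult_mat_vec_split[OF A A v w])
qed

lemma double_rep_in_GL:
  fixes A :: "'k::field mat"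
  assumes A: "A \<in> carrier_mat 4 4" and d: "det A = 1"
  shows "double_rep A \<in> carrier (GL 9)"
proof -
  have B: "adj_mat A \<in> carrier_mat 4 4" "A * adj_mat A = 1\<^sub>m 4" "adj_mat A * A = 1\<^sub>m 4"
    using adj_mat[OF A] d by auto
  have "double_rep A * double_rep (adj_mat A) = 1\<^sub>m 9" "double_rep (adj_mat A) * double_rep A = 1\<^sub>m 9"
    unfolding double_rep_mult[OF A B(1), symmetric] double_rep_mult[OF B(1) A, symmetric] B(2,3)
    by (rule double_rep_one)+
  then have "invertible_mat (double_rep A)"
    unfolding invertible_mat_def inverts_mat_def
    using double_rep_carrier[OF A] double_rep_carrier[OF B(1)] by auto
  then show ?thesis using double_rep_carrier[OF A] by (simp add: GL_def)
qed

section \<open>Actions that lift to four-space\<close>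

lemma spin_coverE:
  assumes "spin_cover Q \<pi>"
  obtains P P' where "P \<in> carrier_mat 6 6" "P' \<in> carrier_mat 6 6" "P * P' = 1\<^sub>m 6" "P' * P = 1\<^sub>m 6"
    "transpose_mat P * Q * P = wedge_pairing" "\<And>A. A \<in> carrier (SL 4) \<Longrightarrow> \<pi> A * P = P * wedge2 A"
proof -
  obtain P where P: "P \<in> carrier (GL 6)" "transpose_mat P * Q * P = wedge_pairing"
    "\<forall>A\<in>carrier (SL 4). \<pi> A \<in> carrier_mat 6 6 \<and> \<pi> A * P = P * wedge2 A"
    using assms unfolding spin_cover_def by blast
  have c: "P \<in> carrier_mat 6 6" "invertible_mat P" using P(1) by (auto simp: GL_def)
  then obtain P' where P': "P * P' = 1\<^sub>m (dim_row P)" "P' * P = 1\<^sub>m (dim_row P')"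
    unfolding invertible_mat_def inverts_mat_def by blast
  have "dim_row (P' * P) = dim_col (P' * P)" "dim_row (P * P') = dim_col (P * P')"
    unfolding P' by simp_all
  then have d: "dim_row P' = 6" "dim_col P' = 6" using c(1) by auto
  show ?thesis
  proof (rule that[OF c(1) _ _ _ P(2)])
    show "P' \<in> carrier_mat 6 6" using d by (intro carrier_matI)
    show "P * P' = 1\<^sub>m 6" "P' * P = 1\<^sub>m 6" using P' d c(1) by auto
    show "\<pi> A * P = P * wedge2 A" if "A \<in> carrier (SL 4)" for A using P(3) that by blast
  qed
qed

text \<open>
  The theorem in terms of an explicit linear lift \<open>A\<close> of the action from \<open>\<And>\<^sup>2 k\<^sup>4\<close> to \<open>k\<^sup>4\<close> and a single point with
  trivial stabiliser.  The factor that is added to \<open>X\<close> is \<open>\<P>\<^sup>4\<close>, since \<open>V \<oplus> V\<close> has dimension \<open>8 = dim X + 4\<close>.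
\<close>

lemma stably_linearizable_of_lift:
  fixes Q :: "'k::field_char_0 mat" and A :: "'k mat \<Rightarrow> 'k mat"
  assumes Q: "Q \<in> carrier_mat 6 6" and P: "P \<in> carrier_mat 6 6" and P': "P' \<in> carrier_mat 6 6"
    and PP': "P * P' = 1\<^sub>m 6" and P'P: "P' * P = 1\<^sub>m 6"
    and isometry: "transpose_mat P * Q * P = wedge_pairing"
    and H: "carrier H = G" "mult H = (*)"
    and G: "finite G" "G \<subseteq> carrier_mat 6 6" "\<And>g. g \<in> G \<Longrightarrow> det g = 1" "1\<^sub>m 6 \<in> G"
    and closed: "\<And>g g'. g \<in> G \<Longrightarrow> g' \<in> G \<Longrightarrow> g * g' \<in> G"
    and A: "\<And>g. g \<in> G \<Longrightarrow> A g \<in> carrier_mat 4 4" "\<And>g. g \<in> G \<Longrightarrow> det (A g) = 1"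
    and A_mult: "\<And>g g'. g \<in> G \<Longrightarrow> g' \<in> G \<Longrightarrow> A (g * g') = A g * A g'"
    and lift: "\<And>g. g \<in> G \<Longrightarrow> g * P = P * wedge2 (A g)"
    and p0: "p0 \<in> quadric 6 Q" and free: "\<And>g. g \<in> G \<Longrightarrow> proj_action g p0 = p0 \<Longrightarrow> g = 1\<^sub>m 6"
  shows "stably_linearizable H 6 (quadric 6 Q) proj_action"
proof -
  obtain x0 where x0_mem: "x0 \<in> p0" using p0 quadric_subset proj_space_nonempty by blast
  have p0': "p0 \<in> proj_space 6" using p0 quadric_subset by blast
  note x0 = proj_space_memD[OF p0' x0_mem]
  have x0_zero: "quad_form Q x0 = 0" using p0 x0_mem unfolding quadric_def by blast
  have "\<exists>e h. form 6 e h \<and> h x0 \<noteq> 0 \<and> (\<forall>g\<in>G - {1\<^sub>m 6}. h (g *\<^sub>v x0) = 0)"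
    by (rule separating_form[OF G(1,2) x0(1,2)]) (use free in \<open>simp only: x0(3)[symmetric]\<close>)
  then obtain e h where h: "form 6 e h" "h x0 \<noteq> 0" "\<forall>g\<in>G - {1\<^sub>m 6}. h (g *\<^sub>v x0) = 0" by blast
  define y where "y = P' *\<^sub>v x0"
  have y: "y \<in> carrier_vec 6" "P *\<^sub>v y = x0"
    unfolding y_def using P' x0(1) assoc_mult_mat_vec[OF P P' x0(1)] PP' by simp_all
  have "y \<noteq> 0\<^sub>v 6"
  proof
    assume "y = 0\<^sub>v 6"
    then have "x0 = 0\<^sub>v 6" using y(2) P by (auto intro!: eq_vecI)
    then show False using x0(2) by contradiction
  qed
  with y(1) obtain i j where ij: "i < 4" "j < 4" "unit_vec 4 i \<bullet> (alt_mat y *\<^sub>v unit_vec 4 j) \<noteq> 0"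
    by (rule alt_mat_entry_nonzero)
  have A_one: "A (1\<^sub>m 6) = 1\<^sub>m 4"
  proof -
    let ?E = "A (1\<^sub>m 6)"
    have E: "?E \<in> carrier_mat 4 4" "?E * ?E = ?E" using A(1) G(4) A_mult[OF G(4) G(4)] by simp_all
    have B: "adj_mat ?E \<in> carrier_mat 4 4" "?E * adj_mat ?E = 1\<^sub>m 4"
      using adj_mat[OF E(1)] A(2)[OF G(4)] by auto
    have "?E = ?E * (?E * adj_mat ?E)" using E(1) B(2) by simp
    also have "\<dots> = ?E * ?E * adj_mat ?E" by (rule assoc_mult_mat[OF E(1,1) B(1), symmetric])
    finally show ?thesis unfolding E(2) B(2) .
  qed
  \<comment> \<open>At \<open>x0\<close> the two fields are multiples of the coordinates \<open>j\<close> and \<open>i\<close>, which are independent on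
    the plane of \<open>x0\<close> by the choice of \<open>i\<close> and \<open>j\<close>.\<close>
  interpret framed_quadric Q P P' e "avg_covector G A 4 h j" "avg_covector G A 4 h i" "avg G h"
    by unfold_locales (use Q P P' PP' P'P isometry in \<open>auto intro: vec_form_avg_covector[OF G(1,2) h(1)] form_avg[OF G(1,2) h(1)]\<close>)
  note at_x0 = avg_at_separated_point[OF G(1,4) x0(1) h(3)]
  have N0: "avg G h x0 \<noteq> 0" using at_x0(1) h(2) by simp
  have "\<delta> x0 = h x0 * (h x0 * (unit_vec 4 i \<bullet> (alt_mat y *\<^sub>v unit_vec 4 j)))"
    unfolding \<delta>_def contract_def at_x0(2)[where A = A and r = 4, OF A_one ij(1)]
      at_x0(2)[where A = A and r = 4, OF A_one ij(2)] y_def[symmetric]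
      mult_mat_vec[OF alt_mat_carrier unit_vec_carrier]
    by simp
  then have delta0: "\<delta> x0 \<noteq> 0" using h(2) ij(3) by simp
  have point_equiv: "point (double_rep (A g) *\<^sub>v u) = g *\<^sub>v point u"
    and coords_equiv: "coords (double_rep (A g) *\<^sub>v u) = coords u"
    if g: "g \<in> G" and u: "u \<in> carrier_vec 9" for g u
  proof -
    let ?u = "double_rep (A g) *\<^sub>v u"
    have "?u = pair_vec (A g *\<^sub>v fst_vec u) (A g *\<^sub>v snd_vec u) (u $ 8)"
      using double_rep_pair_vec[OF A(1)[OF g] fst_snd_vec_carrier] pair_vec_fst_snd[OF u] by metis
    then have c: "fst_vec ?u = A g *\<^sub>v fst_vec u" "snd_vec ?u = A g *\<^sub>v snd_vec u" "?u $ 8 = u $ 8"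
      using A(1)[OF g] by (simp_all add: pair_vec_components)
    have gc: "g \<in> carrier_mat 6 6" using g G(2) by blast
    have w: "wedge2 (A g) \<in> carrier_mat 6 6" by (simp add: wedge2_def)
    have "point ?u = P *\<^sub>v (wedge2 (A g) *\<^sub>v wedge_vec (fst_vec u) (snd_vec u))"
      unfolding point_def span_point_def c wedge2_mult_wedge_vec[OF A(1)[OF g] fst_snd_vec_carrier] ..
    also have "\<dots> = (g * P) *\<^sub>v wedge_vec (fst_vec u) (snd_vec u)"
      unfolding lift[OF g] assoc_mult_mat_vec[OF P w wedge_vec_carrier(1)] ..
    also have "\<dots> = g *\<^sub>v point u"
      unfolding point_def span_point_def by (rule assoc_mult_mat_vec[OF gc P wedge_vec_carrier(1)])
    finally show p: "point ?u = g *\<^sub>v point u" .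
    have cov: "avg_covector G A 4 h l (g *\<^sub>v point u) \<bullet> (A g *\<^sub>v v) = avg_covector G A 4 h l (point u) \<bullet> v"
      if "l < 4" "v \<in> carrier_vec 4" for l v
      by (rule avg_covector_equivariant[OF G(1,2) closed A(1) A_mult g G(3)[OF g] point_carrier that])
    have inv: "avg G h (g *\<^sub>v point u) = avg G h (point u)"
      by (rule avg_invariant[OF G(1,2) closed g G(3)[OF g] point_carrier])
    show "coords ?u = coords u"
      unfolding coords_def p c inv using cov[OF ij(1)] cov[OF ij(2)] by simp
  qed
  have hom: "(\<lambda>g. double_rep (A g)) \<in> hom H (GL 9)"
    unfolding hom_def H using double_rep_in_GL[OF A(1) A(2)] double_rep_mult[OF A(1) A(1)] A_mult
    by (auto simp: GL_def)
  have equivariant: "proj_map forward (proj_action (double_rep (A g)) p)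
      = prod_action (quadric 6 Q) (proj_space 5) proj_action g (proj_map forward p)"
    if g: "g \<in> G" and p: "p \<in> forward_domain" and gp: "proj_action (double_rep (A g)) p \<in> forward_domain" for g p
  proof -
    have p9: "p \<in> proj_space 9" using p unfolding forward_domain_def principal_open_def by blast
    then obtain u where u: "u \<in> p" by (rule proj_space_nonempty)
    note u = proj_space_memD[OF p9 u]
    have gu: "proj_action (double_rep (A g)) p = proj_point (double_rep (A g) *\<^sub>v u)"
      unfolding u(3) by (rule proj_action_proj_point[OF double_rep_carrier[OF A(1)[OF g]] u(1)])
    have forward_domain: "proj_point u \<in> forward_domain" "proj_point (double_rep (A g) *\<^sub>v u) \<in> forward_domain"
      using p gp unfolding gu u(3)[symmetric] by auto
    have gc: "g \<in> carrier_mat 6 6" using g G(2) by blast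
    have "proj_map forward (proj_action (double_rep (A g)) p)
        = segre (proj_point (g *\<^sub>v point u)) (proj_point (coords u))"
      unfolding gu proj_map_forward[OF forward_domain(2)] point_equiv[OF g u(1)] coords_equiv[OF g u(1)] ..
    also have "\<dots> = segre (proj_action g (proj_point (point u))) (proj_point (coords u))"
      unfolding proj_action_proj_point[OF gc point_carrier] ..
    also have "\<dots> = prod_action (quadric 6 Q) (proj_space 5) proj_action g
        (segre (proj_point (point u)) (proj_point (coords u)))"
      by (rule prod_action_segre[OF quadric_subset subset_refl point_in_quadric[OF forward_domain(1)]
            proj_point_in_proj_space[OF coords_carrier point_coords_nonzero(2)[OF forward_domain(1)]], symmetric])
    also have "\<dots> = prod_action (quadric 6 Q) (proj_space 5) proj_action g (proj_map forward p)"
      unfolding u(3) proj_map_forward[OF forward_domain(1)] ..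
    finally show ?thesis .
  qed
  have "linearizable H (6 * 5) (prod_variety (quadric 6 Q) (proj_space 5))
      (prod_action (quadric 6 Q) (proj_space 5) proj_action)"
    unfolding linearizable_def
    using hom birational_map_forward[OF x0(1) x0_zero N0 delta0] equivariant H(1)
    by (intro exI[of _ 9] exI[of _ "\<lambda>g. double_rep (A g)"] exI[of _ forward_domain] exI[of _ "proj_map forward"]) blast
  moreover have "Suc 4 = 5" by simp
  ultimately show ?thesis
    unfolding stably_linearizable_def by metis
qed

theorem theorem5p8:
  fixes Q :: "'k::{alg_closed_field, field_char_0} mat"
    and \<pi> :: "'k mat \<Rightarrow> 'k mat"
    and G :: "'k mat set"
  assumes "sym_mat 6 Q" and "smooth_quadric 6 Q"
    and "spin_cover Q \<pi>"
    and "subgroup G (SO 6 Q)" and "finite G"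
    and "generically_free (SO 6 Q\<lparr>carrier := G\<rparr>) 6 (quadric 6 Q) proj_action"
    and "splits (SL 4\<lparr>carrier := cover_preimage \<pi> G\<rparr>) \<pi> (SO 6 Q\<lparr>carrier := G\<rparr>)"
  shows "stably_linearizable (SO 6 Q\<lparr>carrier := G\<rparr>) 6 (quadric 6 Q) proj_action"
proof -
  have Q: "Q \<in> carrier_mat 6 6" using assms(1) unfolding sym_mat_def by blast
  obtain P P' where P: "P \<in> carrier_mat 6 6" "P' \<in> carrier_mat 6 6" "P * P' = 1\<^sub>m 6" "P' * P = 1\<^sub>m 6"
    "transpose_mat P * Q * P = wedge_pairing" and cover: "\<And>A. A \<in> carrier (SL 4) \<Longrightarrow> \<pi> A * P = P * wedge2 A"
    using spin_coverE[OF assms(3)] by blast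
  obtain s where s: "s \<in> hom (SO 6 Q\<lparr>carrier := G\<rparr>) (SL 4\<lparr>carrier := cover_preimage \<pi> G\<rparr>)"
    and section_s: "\<forall>g\<in>carrier (SO 6 Q\<lparr>carrier := G\<rparr>). \<pi> (s g) = g"
    using assms(7) unfolding splits_def by blast
  have SL: "s g \<in> carrier (SL 4)" if "g \<in> G" for g
    using s that unfolding hom_def cover_preimage_def by auto
  obtain p0 where p0: "p0 \<in> quadric 6 Q" "\<forall>g\<in>G. proj_action g p0 = p0 \<longrightarrow> g = 1\<^sub>m 6"
  proof -
    obtain U where U: "openin (zariski_on 6 (quadric 6 Q)) U" "U \<noteq> {}"
      "\<forall>p\<in>U. \<forall>g\<in>G. proj_action g p = p \<longrightarrow> g = 1\<^sub>m 6"
      using assms(6) unfolding generically_free_def by (auto simp: SO_def)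
    then show ?thesis using that openin_zariski_on_subset[OF U(1)] by blast
  qed
  have G: "G \<subseteq> carrier (SO 6 Q)" using assms(4) by (rule subgroup.subset)
  show ?thesis
  proof (rule stably_linearizable_of_lift[OF Q P _ _ assms(5), where A = s])
    show "carrier (SO 6 Q\<lparr>carrier := G\<rparr>) = G" by simp
    show "mult (SO 6 Q\<lparr>carrier := G\<rparr>) = (*)" by (simp add: SO_def)
    show "G \<subseteq> carrier_mat 6 6" using G by (auto simp: SO_def)
    show "det g = 1" if "g \<in> G" for g using G that by (auto simp: SO_def)
    show "1\<^sub>m 6 \<in> G" using subgroup.one_closed[OF assms(4)] by (simp add: SO_def)
    show "g * g' \<in> G" if "g \<in> G" "g' \<in> G" for g g'
      using subgroup.m_closed[OF assms(4) that] by (simp add: SO_def)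
    show "s g \<in> carrier_mat 4 4" "det (s g) = 1" if "g \<in> G" for g
      using SL[OF that] by (auto simp: SL_def)
    show "s (g * g') = s g * s g'" if "g \<in> G" "g' \<in> G" for g g'
      using s that unfolding hom_def by (simp add: SO_def SL_def)
    show "g * P = P * wedge2 (s g)" if "g \<in> G" for g
      using cover[OF SL[OF that]] section_s that by simp
    show "p0 \<in> quadric 6 Q" by (rule p0(1))
    show "g = 1\<^sub>m 6" if "g \<in> G" "proj_action g p0 = p0" for g using p0(2) that by blast
  qed
qed

end
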